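(* Let $G$ be an lcsc group with Haar measure $m_G$ and let $d$ be a left-invariant metric on $G$ whose closed balls $B_t=\{g: d(e,g)\le t\}$ are compact of positive measure for $t>0$. Assume that the balls satisfy the doubling condition $m_G(B_{2t})\le C\,m_G(B_t)$ for all $t>0$, and that they are asymptotically invariant under right translations, i.e. $\lim_{t\to\infty}m_G(B_tg\,\Delta\,B_t)/m_G(B_t)=0$ for every $g\in G$. Then the ball averages $\beta_t$ (probability measures with density $\chi_{B_t}/m_G(B_t)$) satisfy the pointwise ergodic theorem in $L^p$ for every $1\le p<\infty$.
   Context: For a measure-preserving action of $G$ on a probability space $(X,m)$ and a probability measure $\mu$ on $G$, $\pi(\mu)f(x)=\int_G f(g^{-1}x)\,d\mu(g)$. A family $\mu_t$ ($t\to\infty$) of probability measures on $G$ satisfies the pointwise ergodic theorem in $L^p$ if for every ergodic measure-preserving action of $G$ on a standard probability space $(X,m)$ and every $f\in L^p(X)$, $\lim_{t\to\infty}\pi(\mu_t)f(x)=\int_X f\,dm$ for $m$-almost every $x$ and in the $L^p(X)$-norm. *)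

theory Defs
  imports "HOL-Analysis.Analysis" "HOL-Probability.Probability"
begin

definition lcsc_group ::
  "('g::{t2_space,second_countable_topology} \<Rightarrow> 'g \<Rightarrow> 'g) \<Rightarrow> ('g \<Rightarrow> 'g) \<Rightarrow> 'g \<Rightarrow> bool" where
  "lcsc_group mul ginv e \<longleftrightarrow>
     (\<forall>x y z. mul (mul x y) z = mul x (mul y z)) \<and>
     (\<forall>x. mul e x = x \<and> mul x e = x) \<and>
     (\<forall>x. mul (ginv x) x = e \<and> mul x (ginv x) = e) \<and>
     continuous_on UNIV (\<lambda>p::'g \<times> 'g. mul (fst p) (snd p)) \<and>
     continuous_on UNIV ginv \<and>
     locally_compact_space (euclidean :: 'g topology)"

definition haar_measure ::
  "('g::{t2_space,second_countable_topology} \<Rightarrow> 'g \<Rightarrow> 'g) \<Rightarrow> 'g measure \<Rightarrow> bool" where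
  "haar_measure mul mG \<longleftrightarrow>
     sets mG = sets borel \<and>
     (\<forall>g A. A \<in> sets borel \<longrightarrow> emeasure mG (mul g ` A) = emeasure mG A) \<and>
     (\<forall>K. compact K \<longrightarrow> emeasure mG K < \<infinity>) \<and>
     (\<forall>U. open U \<and> U \<noteq> {} \<longrightarrow> emeasure mG U > 0)"

definition left_invariant_metric ::
  "('g::topological_space \<Rightarrow> 'g \<Rightarrow> 'g) \<Rightarrow> ('g \<Rightarrow> 'g \<Rightarrow> real) \<Rightarrow> bool" where
  "left_invariant_metric mul d \<longleftrightarrow>
     (\<forall>x y. d x y = 0 \<longleftrightarrow> x = y) \<and>
     (\<forall>x y. d x y = d y x) \<and>
     (\<forall>x y z. d x z \<le> d x y + d y z) \<and>
     (\<forall>U. open U \<longleftrightarrow> (\<forall>x\<in>U. \<exists>r>0. \<forall>y. d x y < r \<longrightarrow> y \<in> U)) \<and>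
     (\<forall>g x y. d (mul g x) (mul g y) = d x y)"

definition ball_d :: "('g \<Rightarrow> 'g \<Rightarrow> real) \<Rightarrow> 'g \<Rightarrow> real \<Rightarrow> 'g set" where
  "ball_d d e t = {g. d e g \<le> t}"

definition symdiff :: "'a set \<Rightarrow> 'a set \<Rightarrow> 'a set" where
  "symdiff A B = (A - B) \<union> (B - A)"

definition mp_action ::
  "('g \<Rightarrow> 'g \<Rightarrow> 'g) \<Rightarrow> 'g \<Rightarrow> 'g measure \<Rightarrow> ('g \<Rightarrow> 'x \<Rightarrow> 'x) \<Rightarrow> 'x measure \<Rightarrow> bool" where
  "mp_action mul e mG a mX \<longleftrightarrow>
     (\<lambda>p. a (fst p) (snd p)) \<in> measurable (mG \<Otimes>\<^sub>M mX) mX \<and>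
     (\<forall>x\<in>space mX. a e x = x) \<and>
     (\<forall>g h. \<forall>x\<in>space mX. a (mul g h) x = a g (a h x)) \<and>
     (\<forall>g. a g \<in> measurable mX mX \<and> distr mX mX (a g) = mX)"

definition ergodic_action :: "('g \<Rightarrow> 'x \<Rightarrow> 'x) \<Rightarrow> 'x measure \<Rightarrow> bool" where
  "ergodic_action a mX \<longleftrightarrow>
     (\<forall>A \<in> sets mX. (\<forall>g. a g -` A \<inter> space mX = A) \<longrightarrow> measure mX A = 0 \<or> measure mX A = 1)"

definition ball_average ::
  "('g \<Rightarrow> 'g) \<Rightarrow> 'g measure \<Rightarrow> 'g set \<Rightarrow> ('g \<Rightarrow> 'x \<Rightarrow> 'x) \<Rightarrow> ('x \<Rightarrow> real) \<Rightarrow> 'x \<Rightarrow> real" where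
  "ball_average ginv mG B a f x = (1 / measure mG B) * (LINT g:B|mG. f (a (ginv g) x))"

end

theory Submission
  imports Defs
begin

text \<open>
  Writing \<open>F u = f (u\<inverse> x)\<close>, the ball average of \<open>f\<close> at \<open>h\<inverse> x\<close> is the mean of \<open>F\<close> over the
  \<open>d\<close>-ball around \<open>h\<close>, so the Hardy--Littlewood maximal inequality on \<open>G\<close>, which follows from
  doubling by a Vitali covering argument, transfers to a weak type (1,1) inequality on \<open>X\<close>.
  Asymptotic right invariance of the balls makes \<open>G\<close> unimodular and the averages asymptotically
  invariant. For bounded \<open>f\<close>, consider the bounded functions whose averages are asymptotic to those
  of \<open>f\<close>. They form a convex translation invariant set, an element of nearly minimal \<open>L\<^sup>2\<close> norm
  is nearly invariant, and by ergodicity it is nearly equal to the constant \<open>\<integral> f\<close> in \<open>L\<^sup>1\<close>. The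
  maximal inequality turns this into convergence almost everywhere, and truncation extends it to
  \<open>L\<^sup>1\<close>. Norm convergence in \<open>L\<^sup>p\<close> follows by truncation, since the averages contract \<open>L\<^sup>p\<close>.
\<close>

section \<open>Unimodularity\<close>

text \<open>Two different shifts of the averages must be controlled. Composing \<open>f\<close> with
  \<open>a h\<close> turns the ball \<open>B t\<close> into a right translate, the kind that the
  hypothesis speaks of. Moving the base point from \<open>x\<close> to \<open>a h x\<close> turns it
  into a left translate. Inversion exchanges left and right translates of the symmetric balls, but
  it respects the measure only in a unimodular group, and so do right changes of variables; this is
  why unimodularity comes first.

  Ergodicity is formulated for sets invariant under every \<open>a g\<close> at every point, and the
  group may be uncountable, so null sets depending on \<open>g\<close> cannot simply be collected.
  For bounded \<open>f\<close> the asymptotic invariance holds at every \<open>x\<close> without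
  exception, and this is what bounded functions buy: the limit function is invariant everywhere.

  The radius is a real parameter, but the maximal inequality runs over integer radii, which keeps
  its level sets measurable; doubling compares a real radius with the next integer.\<close>

locale doubling_group =
  fixes mul :: "'g::{t2_space,second_countable_topology} \<Rightarrow> 'g \<Rightarrow> 'g"
    and ginv :: "'g \<Rightarrow> 'g" and e :: 'g
    and mG :: "'g measure" and d :: "'g \<Rightarrow> 'g \<Rightarrow> real" and C :: real
  assumes grp: "lcsc_group mul ginv e"
    and haar: "haar_measure mul mG"
    and metric: "left_invariant_metric mul d"
    and compact_balls: "\<And>t. t > 0 \<Longrightarrow> compact (ball_d d e t)"
    and pos_balls: "\<And>t. t > 0 \<Longrightarrow> emeasure mG (ball_d d e t) > 0"
    and doubling: "\<And>t. t > 0 \<Longrightarrow> measure mG (ball_d d e (2 * t)) \<le> C * measure mG (ball_d d e t)"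
    and asymp_inv: "\<And>g. ((\<lambda>t. measure mG (symdiff ((\<lambda>h. mul h g) ` ball_d d e t) (ball_d d e t))
                              / measure mG (ball_d d e t)) \<longlongrightarrow> 0) at_top"
begin

section \<open>Algebra of the group and elementary properties of the balls\<close>

abbreviation B :: "real \<Rightarrow> 'g set" where "B \<equiv> ball_d d e"

lemma mul_assoc: "mul (mul x y) z = mul x (mul y z)"
  using grp by (simp add: lcsc_group_def)

lemma mul_e [simp]: "mul e x = x" "mul x e = x"
  using grp by (simp_all add: lcsc_group_def)

lemma mul_ginv [simp]: "mul (ginv x) x = e" "mul x (ginv x) = e"
  using grp by (simp_all add: lcsc_group_def)

lemma mul_ginv_cancel [simp]: "mul (ginv x) (mul x y) = y" "mul x (mul (ginv x) y) = y"
  by (simp_all flip: mul_assoc)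

lemma ginv_unique: "mul x y = e \<Longrightarrow> ginv x = y"
  using mul_ginv_cancel(1)[of x y] by simp

lemma ginv_ginv [simp]: "ginv (ginv x) = x"
  by (rule ginv_unique) simp

lemma ginv_mul: "ginv (mul x y) = mul (ginv y) (ginv x)"
  by (rule ginv_unique) (simp add: mul_assoc)

lemma sets_mG [measurable_cong, simp]: "sets mG = sets borel"
  using haar by (simp add: haar_measure_def)

lemma space_mG [simp]: "space mG = UNIV"
  using sets_eq_imp_space_eq[OF sets_mG] by simp

lemma continuous_mul: "continuous_on UNIV (\<lambda>p. mul (fst p) (snd p))"
  using grp by (simp add: lcsc_group_def)

lemma continuous_ginv: "continuous_on UNIV ginv"
  using grp by (simp add: lcsc_group_def)

lemma measurable_mul [measurable (raw)]:
  assumes "f \<in> M \<rightarrow>\<^sub>M borel" "h \<in> M \<rightarrow>\<^sub>M borel"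
  shows "(\<lambda>x. mul (f x) (h x)) \<in> M \<rightarrow>\<^sub>M borel"
  using borel_measurable_continuous_Pair[OF assms continuous_mul] .

lemma measurable_ginv [measurable]: "ginv \<in> borel \<rightarrow>\<^sub>M borel"
  using continuous_ginv by (rule borel_measurable_continuous_onI)

lemma dist_sym: "d x y = d y x"
  and dist_triangle: "d x z \<le> d x y + d y z"
  and dist_left_inv: "d (mul g x) (mul g y) = d x y"
  and dist_self [simp]: "d x x = 0"
  using metric unfolding left_invariant_metric_def by simp_all

lemma dist_e_mul: "d e (mul (ginv x) y) = d x y"
  using dist_left_inv[of x e "mul (ginv x) y"] by simp

lemma in_ball_iff: "g \<in> B t \<longleftrightarrow> d e g \<le> t"
  by (simp add: ball_d_def)

lemma ball_mono: "s \<le> t \<Longrightarrow> B s \<subseteq> B t"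
  by (auto simp: in_ball_iff)

lemma ball_measurable: "t > 0 \<Longrightarrow> B t \<in> sets borel"
  by (intro borel_closed compact_imp_closed compact_balls)

lemma emeasure_ball_finite: "t > 0 \<Longrightarrow> emeasure mG (B t) < \<infinity>"
  using haar compact_balls by (simp add: haar_measure_def)

lemma emeasure_ball: "t > 0 \<Longrightarrow> emeasure mG (B t) = ennreal (measure mG (B t))"
  using emeasure_ball_finite[of t] by (simp add: emeasure_eq_ennreal_measure less_top)

lemma measure_ball_pos: "t > 0 \<Longrightarrow> measure mG (B t) > 0"
  using pos_balls[of t] by (simp add: emeasure_ball)

lemma measure_ball_mono: "0 < s \<Longrightarrow> s \<le> t \<Longrightarrow> measure mG (B s) \<le> measure mG (B t)"
  using ball_mono[of s t] emeasure_ball_finite[of t]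
  by (intro measure_mono_fmeasurable) (auto simp: fmeasurable_def ball_measurable)

text \<open>Makes the coercion of \<open>C\<close> to \<open>ennreal\<close> faithful; a negative
  real would become 0.\<close>

lemma C_ge_1: "C \<ge> 1"
proof -
  have "1 * measure mG (B 1) \<le> measure mG (B (2 * 1))"
    using measure_ball_mono[of 1 2] by simp
  also have "\<dots> \<le> C * measure mG (B 1)"
    by (rule doubling) simp
  finally show ?thesis
    using measure_ball_pos[of 1] by (simp add: mult_le_cancel_right)
qed

lemma sigma_finite_mG: "sigma_finite_measure mG"
proof
  have "\<exists>n::nat. d e x \<le> real n + 1" for x
    using real_arch_simple[of "d e x"] by (meson add_increasing2 order.refl order.trans zero_le_one)
  \<comment> \<open>The radii start at 1 because compactness, and with it finite measure, is given
    for positive radii.\<close>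
  then have "(\<Union>n::nat. B (real n + 1)) = UNIV"
    by (auto simp: in_ball_iff)
  then show "\<exists>A. countable A \<and> A \<subseteq> sets mG \<and> \<Union> A = space mG \<and> (\<forall>a\<in>A. emeasure mG a \<noteq> \<infinity>)"
    using emeasure_ball_finite
    by (intro exI[of _ "range (\<lambda>n::nat. B (real n + 1))"]) (auto simp: ball_measurable less_top)
qed

sublocale mG: sigma_finite_measure mG
  by (rule sigma_finite_mG)

sublocale GG: pair_sigma_finite mG mG ..

section \<open>Translations, inversion and the Haar measure\<close>

lemma distr_left_translation: "distr mG mG (mul g) = mG"
proof (rule measure_eqI)
  fix A assume "A \<in> sets (distr mG mG (mul g))"
  then have A: "A \<in> sets borel" by simp
  have "mul g -` A = mul (ginv g) ` A"
  proof (rule set_eqI)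
    fix x show "x \<in> mul g -` A \<longleftrightarrow> x \<in> mul (ginv g) ` A"
      by (metis imageE imageI mul_ginv_cancel vimageE vimageI)
  qed
  with A show "emeasure (distr mG mG (mul g)) A = emeasure mG A"
    using haar by (simp add: emeasure_distr haar_measure_def)
qed simp

lemma nn_integral_left_translation:
  assumes [measurable]: "F \<in> borel_measurable borel"
  shows "(\<integral>\<^sup>+x. F (mul g x) \<partial>mG) = (\<integral>\<^sup>+x. F x \<partial>mG)"
proof -
  have "(\<integral>\<^sup>+x. F x \<partial>distr mG mG (mul g)) = (\<integral>\<^sup>+x. F (mul g x) \<partial>mG)"
    by (rule nn_integral_distr) measurable
  then show ?thesis by (simp add: distr_left_translation)
qed

lemma right_translate_eq: "(\<lambda>h. mul h g) ` A = {x. mul x (ginv g) \<in> A}"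
proof (rule set_eqI)
  fix x
  have "x = mul h g \<longleftrightarrow> h = mul x (ginv g)" for h
    by (auto simp: mul_assoc)
  then show "x \<in> (\<lambda>h. mul h g) ` A \<longleftrightarrow> x \<in> {x. mul x (ginv g) \<in> A}"
    by (auto simp: image_iff)
qed

text \<open>As long as right invariance is not established, the measure of a right translate is
  finite by compactness, not by comparison with the ball. Finiteness matters because
  \<open>measure\<close> is 0 on sets of infinite measure.\<close>

lemma right_translate_ball:
  assumes "t > 0"
  shows "(\<lambda>h. mul h g) ` B t \<in> sets borel" "emeasure mG ((\<lambda>h. mul h g) ` B t) < \<infinity>"
proof -
  have "continuous_on (B t) (\<lambda>h. mul h g)"
    using continuous_on_compose2[OF continuous_mul, of "B t" "\<lambda>h. (h, g)"]
    by (simp add: continuous_on_Pair continuous_on_id continuous_on_const)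
  then have "compact ((\<lambda>h. mul h g) ` B t)"
    using compact_balls[OF assms] by (rule compact_continuous_image)
  then show "(\<lambda>h. mul h g) ` B t \<in> sets borel" "emeasure mG ((\<lambda>h. mul h g) ` B t) < \<infinity>"
    using haar by (simp_all add: haar_measure_def borel_closed compact_imp_closed)
qed

lemma right_translate_ball_fmeasurable:
  "t > 0 \<Longrightarrow> (\<lambda>h. mul h g) ` B t \<in> fmeasurable mG" "t > 0 \<Longrightarrow> B t \<in> fmeasurable mG"
  using right_translate_ball emeasure_ball_finite by (auto simp: fmeasurable_def ball_measurable)

text \<open>Two sets differ in measure by at most the measure of their symmetric difference. The
  quotient is a value of the modular function, so the limit 1 is unimodularity in disguise; the
  following lemmas extract it.\<close>

lemma measure_right_translate_ball_tendsto:
  "((\<lambda>t. measure mG ((\<lambda>h. mul h g) ` B t) / measure mG (B t)) \<longlongrightarrow> 1) at_top"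
proof -
  have "((\<lambda>t. measure mG ((\<lambda>h. mul h g) ` B t) / measure mG (B t) - 1) \<longlongrightarrow> 0) at_top"
  proof (rule Lim_null_comparison[OF _ asymp_inv[of g]])
    show "\<forall>\<^sub>F t in at_top. norm (measure mG ((\<lambda>h. mul h g) ` B t) / measure mG (B t) - 1)
        \<le> measure mG (symdiff ((\<lambda>h. mul h g) ` B t) (B t)) / measure mG (B t)"
      using eventually_gt_at_top[of 0]
    proof eventually_elim
      case (elim t)
      let ?A = "(\<lambda>h. mul h g) ` B t"
      note fm = right_translate_ball_fmeasurable(1)[OF elim, of g] right_translate_ball_fmeasurable(2)[OF elim]
      have S: "symdiff ?A (B t) \<in> fmeasurable mG"
        unfolding symdiff_def using fm by (intro fmeasurable.Un fmeasurable.Diff)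
      have "measure mG ?A \<le> measure mG (B t \<union> symdiff ?A (B t))"
        using fm S by (intro measure_mono_fmeasurable) (auto simp: symdiff_def)
      also have "\<dots> \<le> measure mG (B t) + measure mG (symdiff ?A (B t))"
        using fm S by (intro measure_Un_le) auto
      finally have 1: "measure mG ?A - measure mG (B t) \<le> measure mG (symdiff ?A (B t))" by simp
      have "measure mG (B t) \<le> measure mG (?A \<union> symdiff ?A (B t))"
        using fm S by (intro measure_mono_fmeasurable) (auto simp: symdiff_def)
      also have "\<dots> \<le> measure mG ?A + measure mG (symdiff ?A (B t))"
        using fm S by (intro measure_Un_le) auto
      finally have 2: "\<bar>measure mG ?A - measure mG (B t)\<bar> \<le> measure mG (symdiff ?A (B t))"
        using 1 by simp
      have "measure mG ?A / measure mG (B t) - 1 = (measure mG ?A - measure mG (B t)) / measure mG (B t)"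
        using measure_ball_pos[OF elim] by (simp add: field_simps)
      then show ?case
        using 2 measure_ball_pos[OF elim] by (simp add: divide_right_mono)
    qed
  qed
  then show ?thesis
    by (simp add: LIM_zero_iff)
qed

text \<open>By Fubini, \<open>(x, y) \<mapsto> (y\<inverse>, x y)\<close> preserves the product measure.\<close>

lemma nn_integral_inverse_mult:
  assumes [measurable]: "F \<in> borel_measurable borel" "A \<in> sets borel"
  shows "(\<integral>\<^sup>+y. F (ginv y) * emeasure mG {x. mul x y \<in> A} \<partial>mG) = (\<integral>\<^sup>+x. F x \<partial>mG) * emeasure mG A"
proof -
  have "(\<integral>\<^sup>+y. F (ginv y) * emeasure mG {x. mul x y \<in> A} \<partial>mG)
      = (\<integral>\<^sup>+y. \<integral>\<^sup>+x. F (ginv y) * indicator A (mul x y) \<partial>mG \<partial>mG)"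
  proof (rule nn_integral_cong)
    fix y
    have "emeasure mG {x. mul x y \<in> A} = (\<integral>\<^sup>+x. indicator {x. mul x y \<in> A} x \<partial>mG)"
      by (rule nn_integral_indicator[symmetric]) measurable
    also have "\<dots> = (\<integral>\<^sup>+x. indicator A (mul x y) \<partial>mG)"
      by (simp add: indicator_def)
    finally show "F (ginv y) * emeasure mG {x. mul x y \<in> A}
        = (\<integral>\<^sup>+x. F (ginv y) * indicator A (mul x y) \<partial>mG)"
      by (simp add: nn_integral_cmult)
  qed
  also have "\<dots> = (\<integral>\<^sup>+x. \<integral>\<^sup>+y. F (ginv y) * indicator A (mul x y) \<partial>mG \<partial>mG)"
    by (rule GG.Fubini') measurable
  \<comment> \<open>Left invariance in \<open>y\<close>, with \<open>mul (ginv x) y\<close> put for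
    \<open>y\<close>, moves the shift from \<open>A\<close> into \<open>F\<close>; after the second
    exchange, left invariance in \<open>x\<close> removes it there.\<close>
  also have "\<dots> = (\<integral>\<^sup>+x. \<integral>\<^sup>+y. F (mul (ginv y) x) * indicator A y \<partial>mG \<partial>mG)"
  proof (rule nn_integral_cong)
    fix x
    show "(\<integral>\<^sup>+y. F (ginv y) * indicator A (mul x y) \<partial>mG) = (\<integral>\<^sup>+y. F (mul (ginv y) x) * indicator A y \<partial>mG)"
      using nn_integral_left_translation[of "\<lambda>y. F (mul (ginv y) x) * indicator A y" x]
      by (simp add: ginv_mul mul_assoc)
  qed
  also have "\<dots> = (\<integral>\<^sup>+y. \<integral>\<^sup>+x. F (mul (ginv y) x) * indicator A y \<partial>mG \<partial>mG)"
    by (rule GG.Fubini') measurable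
  also have "\<dots> = (\<integral>\<^sup>+y. (\<integral>\<^sup>+x. F x \<partial>mG) * indicator A y \<partial>mG)"
    by (simp add: nn_integral_multc nn_integral_left_translation)
  also have "\<dots> = (\<integral>\<^sup>+x. F x \<partial>mG) * emeasure mG A"
    by (simp add: nn_integral_cmult)
  finally show ?thesis .
qed

text \<open>Asymptotic right invariance of the balls forces unimodularity, by Fatou's lemma.\<close>

lemma nn_integral_inverse_le:
  assumes [measurable]: "F \<in> borel_measurable borel"
  shows "(\<integral>\<^sup>+y. F (ginv y) \<partial>mG) \<le> (\<integral>\<^sup>+x. F x \<partial>mG)"
proof -
  \<comment> \<open>The set in the numerator is the right translate of the ball by
    \<open>ginv y\<close>, so \<open>q n y\<close> tends to 1 for each \<open>y\<close>. By the
    preceding identity, inserting the weight \<open>q n\<close> makes the integral equal to that of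
    \<open>F\<close> for every \<open>n\<close>, which is exactly what Fatou's lemma needs.\<close>
  define q :: "nat \<Rightarrow> 'g \<Rightarrow> ennreal" where
    "q n y = emeasure mG {x. mul x y \<in> B (real n + 1)} / emeasure mG (B (real n + 1))" for n y
  have q_eq: "q n y = ennreal (measure mG ((\<lambda>h. mul h (ginv y)) ` B (real n + 1)) / measure mG (B (real n + 1)))"
    for n y
    using right_translate_ball(2)[of "real n + 1" "ginv y"] measure_ball_pos[of "real n + 1"]
    by (simp add: q_def emeasure_ball right_translate_eq emeasure_eq_ennreal_measure divide_ennreal)
  have [measurable]: "q n \<in> borel_measurable mG" for n
  proof -
    have [measurable]: "B (real n + 1) \<in> sets borel" by (simp add: ball_measurable)
    show ?thesis unfolding q_def by measurable
  qed
  have int_q: "(\<integral>\<^sup>+y. F (ginv y) * q n y \<partial>mG) = (\<integral>\<^sup>+x. F x \<partial>mG)" for n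
  proof -
    have b [measurable]: "B (real n + 1) \<in> sets borel" by (simp add: ball_measurable)
    have "(\<integral>\<^sup>+y. F (ginv y) * q n y \<partial>mG)
        = (\<integral>\<^sup>+y. F (ginv y) * emeasure mG {x. mul x y \<in> B (real n + 1)} / emeasure mG (B (real n + 1)) \<partial>mG)"
      by (simp add: q_def ennreal_times_divide)
    also have "\<dots> = (\<integral>\<^sup>+x. F x \<partial>mG) * emeasure mG (B (real n + 1)) / emeasure mG (B (real n + 1))"
      by (subst nn_integral_divide) (measurable, simp add: nn_integral_inverse_mult[OF _ b])
    also have "\<dots> = (\<integral>\<^sup>+x. F x \<partial>mG)"
      using emeasure_ball_finite[of "real n + 1"] pos_balls[of "real n + 1"]
      by (intro ennreal_mult_divide_eq) auto
    finally show ?thesis .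
  qed
  have lim: "filterlim (\<lambda>n. real n + 1) at_top sequentially"
    by (rule filterlim_at_top_mono[OF filterlim_real_sequentially]) simp
  have "(\<lambda>n. q n y) \<longlonglongrightarrow> ennreal 1" for y
    unfolding q_eq
    by (intro tendsto_ennrealI filterlim_compose[OF measure_right_translate_ball_tendsto lim])
  then have "(\<lambda>n. F (ginv y) * q n y) \<longlonglongrightarrow> F (ginv y) * ennreal 1" for y
    by (intro tendsto_mult_ennreal tendsto_const) auto
  then have "(\<integral>\<^sup>+y. F (ginv y) \<partial>mG) = (\<integral>\<^sup>+y. liminf (\<lambda>n. F (ginv y) * q n y) \<partial>mG)"
    by (intro nn_integral_cong lim_imp_Liminf[symmetric]) simp_all
  also have "\<dots> \<le> liminf (\<lambda>n. \<integral>\<^sup>+y. F (ginv y) * q n y \<partial>mG)"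
    by (intro nn_integral_liminf) measurable
  also have "\<dots> = (\<integral>\<^sup>+x. F x \<partial>mG)"
    by (simp add: int_q Liminf_const)
  finally show ?thesis .
qed

text \<open>Inversion is an involution, so the inequality for the inverted function is the reverse
  inequality.\<close>

lemma nn_integral_inverse:
  assumes [measurable]: "F \<in> borel_measurable borel"
  shows "(\<integral>\<^sup>+y. F (ginv y) \<partial>mG) = (\<integral>\<^sup>+x. F x \<partial>mG)"
  using nn_integral_inverse_le[of F] nn_integral_inverse_le[of "\<lambda>x. F (ginv x)"] by (simp add: antisym)

text \<open>Inversion conjugates right translations into left ones.\<close>

lemma nn_integral_right_translation:
  assumes [measurable]: "F \<in> borel_measurable borel"
  shows "(\<integral>\<^sup>+x. F (mul x g) \<partial>mG) = (\<integral>\<^sup>+x. F x \<partial>mG)"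
proof -
  have "(\<integral>\<^sup>+x. F (mul x g) \<partial>mG) = (\<integral>\<^sup>+x. F (ginv (mul (ginv g) x)) \<partial>mG)"
    using nn_integral_inverse[of "\<lambda>x. F (mul x g)"] by (simp add: ginv_mul)
  also have "\<dots> = (\<integral>\<^sup>+x. F x \<partial>mG)"
    using nn_integral_left_translation[of "\<lambda>x. F (ginv x)" "ginv g"] by (simp add: nn_integral_inverse)
  finally show ?thesis .
qed

lemma distr_right_translation: "distr mG mG (\<lambda>x. mul x g) = mG"
proof (rule measure_eqI)
  fix A assume "A \<in> sets (distr mG mG (\<lambda>x. mul x g))"
  then have [measurable]: "A \<in> sets borel" by simp
  have "emeasure (distr mG mG (\<lambda>x. mul x g)) A = (\<integral>\<^sup>+x. indicator A x \<partial>distr mG mG (\<lambda>x. mul x g))"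
    by simp
  also have "\<dots> = (\<integral>\<^sup>+x. indicator A (mul x g) \<partial>mG)"
    by (rule nn_integral_distr) measurable
  also have "\<dots> = emeasure mG A"
    by (simp add: nn_integral_right_translation)
  finally show "emeasure (distr mG mG (\<lambda>x. mul x g)) A = emeasure mG A" .
qed simp

end

section \<open>The maximal inequality\<close>

text \<open>Selecting balls of large radius first, a centre \<open>h\<close> that is not selected has its ball
  meeting a selected one of at least the same radius, which gives the factor 2.\<close>

lemma vitali_selection:
  fixes d :: "'a \<Rightarrow> 'a \<Rightarrow> real" and r :: "'a \<Rightarrow> nat"
  assumes refl: "\<And>x. d x x = 0" and sym: "\<And>x y. d x y = d y x"
    and tri: "\<And>x y z. d x z \<le> d x y + d y z"
    and bound: "\<And>S. finite S \<Longrightarrow> S \<subseteq> E \<Longrightarrow> disjoint_family_on (\<lambda>s. {h. d s h \<le> real (r s)}) S \<Longrightarrow> card S \<le> K"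
    and "\<And>h. h \<in> E \<Longrightarrow> r h < R"
  shows "\<exists>S. finite S \<and> S \<subseteq> E \<and> disjoint_family_on (\<lambda>s. {h. d s h \<le> real (r s)}) S \<and>
    (\<forall>h\<in>E. \<exists>s\<in>S. d s h \<le> 2 * real (r s))"
  using assms(4-)
proof (induction R arbitrary: E)
  case 0
  then show ?case by (intro exI[of _ "{}"]) (auto simp: disjoint_family_on_def)
next
  case (Suc R)
  let ?Bl = "\<lambda>s. {h. d s h \<le> real (r s)}"
  define \<S> where "\<S> S \<longleftrightarrow> finite S \<and> S \<subseteq> {h \<in> E. r h = R} \<and> disjoint_family_on ?Bl S" for S
  have meet: "d s h \<le> 2 * real (r s)" if "r h \<le> r s" "?Bl h \<inter> ?Bl s \<noteq> {}" for s h
  proof -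
    from that(2) obtain z where "d h z \<le> real (r h)" "d s z \<le> real (r s)" by auto
    then show ?thesis using tri[where x = s and y = z and z = h] sym[of h z] that(1) by simp
  qed
  have "\<S> {}" by (simp add: \<S>_def disjoint_family_on_def)
  \<comment> \<open>The bound on the size of disjoint families guarantees a largest one among the
    balls of the top radius \<open>R\<close>; the induction then descends to smaller radii.\<close>
  moreover have "\<forall>S. \<S> S \<longrightarrow> card S < Suc K"
    unfolding \<S>_def using Suc.prems(1) by (auto simp: less_Suc_eq_le)
  ultimately obtain S0 where S0: "\<S> S0" and max: "\<And>S. \<S> S \<Longrightarrow> card S \<le> card S0"
    using ex_has_greatest_nat[of \<S> "{}" card "Suc K"] by auto
  \<comment> \<open>Disjointness from the balls already chosen is built into the remaining set, so
    the two selections fit together.\<close>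
  define E' where "E' = {h \<in> E. r h < R \<and> (\<forall>s\<in>S0. ?Bl h \<inter> ?Bl s = {})}"
  have "\<exists>S. finite S \<and> S \<subseteq> E' \<and> disjoint_family_on ?Bl S \<and> (\<forall>h\<in>E'. \<exists>s\<in>S. d s h \<le> 2 * real (r s))"
  proof (rule Suc.IH)
    show "card S \<le> K" if "finite S" "S \<subseteq> E'" "disjoint_family_on ?Bl S" for S
      using that by (intro Suc.prems(1)) (auto simp: E'_def)
  qed (simp add: E'_def)
  then obtain S1 where S1: "finite S1" "S1 \<subseteq> E'" "disjoint_family_on ?Bl S1"
    "\<And>h. h \<in> E' \<Longrightarrow> \<exists>s\<in>S1. d s h \<le> 2 * real (r s)" by blast
  have "disjoint_family_on ?Bl (S0 \<union> S1)"
    unfolding disjoint_family_on_def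
  proof (intro ballI impI)
    fix s t assume "s \<in> S0 \<union> S1" "t \<in> S0 \<union> S1" "s \<noteq> t"
    then consider "s \<in> S0" "t \<in> S0" | "s \<in> S1" "t \<in> S1" | "s \<in> S0" "t \<in> S1" | "s \<in> S1" "t \<in> S0"
      by blast
    then show "?Bl s \<inter> ?Bl t = {}"
    proof cases
      case 1 then show ?thesis using S0 \<open>s \<noteq> t\<close> unfolding \<S>_def disjoint_family_on_def by blast
    next
      case 2 then show ?thesis using S1(3) \<open>s \<noteq> t\<close> unfolding disjoint_family_on_def by blast
    next
      case 3 then show ?thesis using S1(2) unfolding E'_def by blast
    next
      case 4 then show ?thesis using S1(2) unfolding E'_def by blast
    qed
  qed
  moreover have "\<exists>s\<in>S0 \<union> S1. d s h \<le> 2 * real (r s)" if "h \<in> E" for h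
  proof (cases "h \<in> E' \<or> h \<in> S0")
    case True
    then show ?thesis
    proof
      assume "h \<in> S0"
      then show ?thesis by (intro bexI[of _ h]) (auto simp: refl)
    qed (use S1(4) in blast)
  next
    case False
    have "\<exists>s\<in>S0. ?Bl h \<inter> ?Bl s \<noteq> {}"
    \<comment> \<open>At the top radius a ball disjoint from all chosen ones could be added, against
      maximality. At a smaller radius such a centre would lie in \<open>E'\<close>.\<close>
    proof (cases "r h = R")
      case True
      have "\<not> \<S> (insert h S0)"
        using max[of "insert h S0"] False S0 by (auto simp: \<S>_def)
      then have "\<not> disjoint_family_on ?Bl (insert h S0)"
        using S0 \<open>h \<in> E\<close> True by (auto simp: \<S>_def)
      then show ?thesis
        using False S0 by (subst (asm) disjoint_family_on_insert) (auto simp: \<S>_def)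
    next
      case False
      with \<open>\<not> (h \<in> E' \<or> h \<in> S0)\<close> Suc.prems(2)[OF \<open>h \<in> E\<close>] \<open>h \<in> E\<close> show ?thesis
        by (auto simp: E'_def)
    qed
    then obtain s where s: "s \<in> S0" "?Bl h \<inter> ?Bl s \<noteq> {}" by blast
    moreover have "r h \<le> r s"
      using S0 s(1) Suc.prems(2)[OF \<open>h \<in> E\<close>] by (auto simp: \<S>_def)
    ultimately show ?thesis using meet by blast
  qed
  moreover have "finite (S0 \<union> S1)" "S0 \<union> S1 \<subseteq> E"
    using S0 S1 by (auto simp: \<S>_def E'_def)
  ultimately show ?case by blast
qed

context doubling_group
begin

lemma left_ball_eq: "{u. d h u \<le> t} = mul h ` B t"
proof (rule set_eqI)
  fix u show "u \<in> {u. d h u \<le> t} \<longleftrightarrow> u \<in> mul h ` B t"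
    using dist_left_inv[of h e] dist_e_mul[of h u]
    by (auto simp: in_ball_iff intro!: image_eqI[of _ _ "mul (ginv h) u"])
qed

lemma left_ball:
  assumes "t > 0"
  shows "{u. d h u \<le> t} \<in> sets borel" "emeasure mG {u. d h u \<le> t} = emeasure mG (B t)"
proof -
  have [measurable]: "B t \<in> sets borel" using assms by (rule ball_measurable)
  have "{u. d h u \<le> t} = {u. mul (ginv h) u \<in> B t}"
    by (simp add: in_ball_iff dist_e_mul)
  also have "\<dots> \<in> sets borel" by measurable
  finally show "{u. d h u \<le> t} \<in> sets borel" .
  show "emeasure mG {u. d h u \<le> t} = emeasure mG (B t)"
    using haar ball_measurable[OF assms] by (simp add: left_ball_eq haar_measure_def)
qed

text \<open>The selected balls are disjoint, and each carries mass at least \<open>L\<close> times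
  its measure; doubling their radii covers \<open>E\<close>, since only centres need covering, and
  costs a single factor \<open>C\<close>. Confining \<open>E\<close> to \<open>B N\<close> and the
  radii to at most \<open>R\<close> keeps everything inside one ball of finite measure, as the
  transfer to the action requires.\<close>

lemma maximal_inequality_group:
  fixes F :: "'g \<Rightarrow> ennreal" and N R :: nat
  assumes F [measurable]: "F \<in> borel_measurable borel" and E: "E \<subseteq> B N" and R: "R \<ge> 1"
    and big: "\<And>h. h \<in> E \<Longrightarrow> \<exists>n\<in>{1..R}. L * emeasure mG (B n) \<le> (\<integral>\<^sup>+u. F u * indicator {u. d h u \<le> real n} u \<partial>mG)"
  shows "L * emeasure mG E \<le> C * (\<integral>\<^sup>+u. F u * indicator (B (real N + real R)) u \<partial>mG)"
proof -
  obtain r where r: "\<And>h. h \<in> E \<Longrightarrow> 1 \<le> r h" "\<And>h. h \<in> E \<Longrightarrow> r h \<le> R"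
    "\<And>h. h \<in> E \<Longrightarrow> L * emeasure mG (B (r h)) \<le> (\<integral>\<^sup>+u. F u * indicator {u. d h u \<le> real (r h)} u \<partial>mG)"
  proof -
    have "\<forall>h\<in>E. \<exists>n. 1 \<le> n \<and> n \<le> R \<and>
        L * emeasure mG (B n) \<le> (\<integral>\<^sup>+u. F u * indicator {u. d h u \<le> real n} u \<partial>mG)"
      using big by (simp add: Bex_def conj_assoc)
    then obtain r where "\<forall>h\<in>E. 1 \<le> r h \<and> r h \<le> R \<and>
        L * emeasure mG (B (r h)) \<le> (\<integral>\<^sup>+u. F u * indicator {u. d h u \<le> real (r h)} u \<partial>mG)"
      by (rule bchoice[THEN exE])
    then show ?thesis by (intro that[of r]) auto
  qed
  let ?Bl = "\<lambda>s. {h. d s h \<le> real (r s)}"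
  let ?V = "\<lambda>t. measure mG (B t)"
  have Bl: "?Bl s \<in> sets borel" "emeasure mG (?Bl s) = emeasure mG (B (r s))" if "s \<in> E" for s
    using left_ball[of "real (r s)" s] r(1)[OF that] by simp_all
  have sub: "?Bl s \<subseteq> B (real N + real R)" if "s \<in> E" for s
  proof
    fix u assume "u \<in> ?Bl s"
    then show "u \<in> B (real N + real R)"
      using dist_triangle[of e u s] E that r(2)[OF that] by (auto simp: in_ball_iff)
  qed
  have NR: "real N + real R > 0" using R by simp
  \<comment> \<open>Disjoint balls of radius at least 1 inside one fixed ball: each uses up at least
    the measure of \<open>B 1\<close>.\<close>
  have "card S \<le> nat \<lfloor>?V (real N + real R) / ?V 1\<rfloor>"
    if S: "finite S" "S \<subseteq> E" "disjoint_family_on ?Bl S" for S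
  proof -
    have "of_nat (card S) * emeasure mG (B 1) \<le> (\<Sum>s\<in>S. emeasure mG (?Bl s))"
    proof (rule sum_bounded_below)
      fix s assume "s \<in> S"
      then have "s \<in> E" using S by auto
      have "emeasure mG (B 1) \<le> emeasure mG (B (r s))"
        using r(1)[OF \<open>s \<in> E\<close>] by (intro emeasure_mono ball_mono) (auto simp: ball_measurable)
      then show "emeasure mG (B 1) \<le> emeasure mG (?Bl s)" by (simp only: Bl[OF \<open>s \<in> E\<close>])
    qed
    also have "\<dots> = emeasure mG (\<Union>s\<in>S. ?Bl s)"
      using S Bl by (intro sum_emeasure) auto
    also have "\<dots> \<le> emeasure mG (B (real N + real R))"
      using S sub NR by (intro emeasure_mono) (auto simp: ball_measurable)
    finally have "real (card S) * ?V 1 \<le> ?V (real N + real R)"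
      using NR by (simp add: emeasure_ball ennreal_of_nat_eq_real_of_nat flip: ennreal_mult)
    then have "real (card S) \<le> ?V (real N + real R) / ?V 1"
      using measure_ball_pos[of 1] by (simp add: pos_le_divide_eq)
    then show ?thesis by linarith
  qed
  note bound = this
  \<comment> \<open>The selection lemma asks for a strict bound on the radii, hence
    \<open>Suc R\<close>.\<close>
  have "\<exists>S. finite S \<and> S \<subseteq> E \<and> disjoint_family_on ?Bl S \<and> (\<forall>h\<in>E. \<exists>s\<in>S. d s h \<le> 2 * real (r s))"
    by (rule vitali_selection[where R = "Suc R", OF dist_self dist_sym dist_triangle bound])
      (use r(2) in \<open>auto simp: less_Suc_eq_le\<close>)
  then obtain S where S: "finite S" "S \<subseteq> E" "disjoint_family_on ?Bl S"
    and cov: "\<And>h. h \<in> E \<Longrightarrow> \<exists>s\<in>S. d s h \<le> 2 * real (r s)"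
    by blast
  have Bl2: "{u. d s u \<le> 2 * real (r s)} \<in> sets borel" if "s \<in> S" for s
    using that S r(1)[of s] by (intro left_ball(1)) auto
  have "emeasure mG E \<le> emeasure mG (\<Union>s\<in>S. {u. d s u \<le> 2 * real (r s)})"
    using cov S Bl2 by (intro emeasure_mono) auto
  also have "\<dots> \<le> (\<Sum>s\<in>S. emeasure mG {u. d s u \<le> 2 * real (r s)})"
    using S Bl2 by (intro emeasure_subadditive_finite) auto
  also have "\<dots> \<le> (\<Sum>s\<in>S. C * emeasure mG (B (r s)))"
  proof (rule sum_mono)
    fix s assume "s \<in> S"
    then have "real (r s) > 0" using S r(1)[of s] by force
    then show "emeasure mG {u. d s u \<le> 2 * real (r s)} \<le> C * emeasure mG (B (r s))"
      using doubling[of "r s"] C_ge_1 by (simp add: left_ball emeasure_ball flip: ennreal_mult)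
  qed
  finally have "L * emeasure mG E \<le> L * (\<Sum>s\<in>S. C * emeasure mG (B (r s)))"
    by (rule mult_left_mono) simp
  also have "\<dots> = C * (\<Sum>s\<in>S. L * emeasure mG (B (r s)))"
    by (simp add: sum_distrib_left mult_ac)
  also have "\<dots> \<le> C * (\<Sum>s\<in>S. \<integral>\<^sup>+u. F u * indicator (?Bl s) u \<partial>mG)"
    using S r(3) by (intro mult_left_mono sum_mono) auto
  also have "(\<Sum>s\<in>S. \<integral>\<^sup>+u. F u * indicator (?Bl s) u \<partial>mG) = (\<integral>\<^sup>+u. (\<Sum>s\<in>S. F u * indicator (?Bl s) u) \<partial>mG)"
    using S Bl by (intro nn_integral_sum[symmetric] borel_measurable_times_ennreal borel_measurable_indicator) auto
  also have "\<dots> = (\<integral>\<^sup>+u. F u * indicator (\<Union>s\<in>S. ?Bl s) u \<partial>mG)"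
    using S by (intro nn_integral_cong) (simp add: indicator_UN_disjoint flip: sum_distrib_left)
  also have "\<dots> \<le> (\<integral>\<^sup>+u. F u * indicator (B (real N + real R)) u \<partial>mG)"
    using S sub by (intro nn_integral_mono mult_left_mono) (auto simp: indicator_def)
  finally show ?thesis by (simp add: mult_left_mono)
qed

end

section \<open>Transfer of the maximal inequality to the action\<close>

locale doubling_group_action = doubling_group mul ginv e mG d C + mX: prob_space mX
  for mul :: "'g::{t2_space,second_countable_topology} \<Rightarrow> 'g \<Rightarrow> 'g"
    and ginv e mG d C and mX :: "'x::topological_space measure" +
  fixes a :: "'g \<Rightarrow> 'x \<Rightarrow> 'x"
  assumes sets_mX [measurable_cong, simp]: "sets mX = sets borel"
    and action: "mp_action mul e mG a mX"
begin

lemma space_mX [simp]: "space mX = UNIV"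
  using sets_eq_imp_space_eq[OF sets_mX] by simp

lemma measurable_mX: "measurable M mX = measurable M borel" "measurable mX M = measurable borel M"
  by (auto intro!: measurable_cong_sets)

sublocale XG: pair_sigma_finite mX mG ..

lemma a_mul: "a (mul g h) x = a g (a h x)"
  using action by (simp add: mp_action_def)

lemma a_e [simp]: "a e x = x"
  using action by (simp add: mp_action_def)

lemma measurable_action [measurable (raw)]:
  assumes [measurable]: "f \<in> M \<rightarrow>\<^sub>M borel" "h \<in> M \<rightarrow>\<^sub>M borel"
  shows "(\<lambda>x. a (f x) (h x)) \<in> M \<rightarrow>\<^sub>M borel"
proof -
  have "(\<lambda>p. a (fst p) (snd p)) \<in> mG \<Otimes>\<^sub>M mX \<rightarrow>\<^sub>M mX"
    using action by (simp add: mp_action_def)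
  from measurable_compose[OF _ this, of "\<lambda>x. (f x, h x)" M]
  have "(\<lambda>x. a (f x) (h x)) \<in> M \<rightarrow>\<^sub>M mX" by simp
  then show ?thesis by (simp add: measurable_mX)
qed

lemma distr_action: "distr mX mX (a g) = mX"
  using action by (simp add: mp_action_def)

lemma nn_integral_action:
  assumes [measurable]: "F \<in> borel_measurable borel"
  shows "(\<integral>\<^sup>+x. F (a g x) \<partial>mX) = (\<integral>\<^sup>+x. F x \<partial>mX)"
proof -
  have "(\<integral>\<^sup>+x. F x \<partial>distr mX mX (a g)) = (\<integral>\<^sup>+x. F (a g x) \<partial>mX)"
    by (rule nn_integral_distr) measurable
  then show ?thesis by (simp add: distr_action)
qed

text \<open>Values in \<open>ennreal\<close> let Fubini apply before integrability along orbits is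
  known. Without normalisation the sum has the form used in the maximal inequality on the
  group.\<close>

definition ball_sum :: "('x \<Rightarrow> ennreal) \<Rightarrow> real \<Rightarrow> 'x \<Rightarrow> ennreal" where
  "ball_sum f t x = (\<integral>\<^sup>+u. f (a (ginv u) x) * indicator (B t) u \<partial>mG)"

lemma measurable_ball_sum [measurable]:
  assumes [measurable]: "f \<in> borel_measurable borel"
  shows "t > 0 \<Longrightarrow> ball_sum f t \<in> borel_measurable borel"
proof -
  assume "t > 0"
  then have [measurable]: "B t \<in> sets borel" by (rule ball_measurable)
  have "ball_sum f t \<in> borel_measurable mX" unfolding ball_sum_def by measurable
  then show ?thesis by (simp add: measurable_mX)
qed

lemma nn_integral_ball_sum:
  assumes [measurable]: "f \<in> borel_measurable borel" and t: "t > 0"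
  shows "(\<integral>\<^sup>+x. ball_sum f t x \<partial>mX) = emeasure mG (B t) * (\<integral>\<^sup>+x. f x \<partial>mX)"
proof -
  have [measurable]: "B t \<in> sets borel" using t by (rule ball_measurable)
  have "(\<integral>\<^sup>+x. ball_sum f t x \<partial>mX) = (\<integral>\<^sup>+u. \<integral>\<^sup>+x. f (a (ginv u) x) * indicator (B t) u \<partial>mX \<partial>mG)"
    unfolding ball_sum_def by (rule XG.Fubini'[symmetric]) measurable
  also have "\<dots> = (\<integral>\<^sup>+u. (\<integral>\<^sup>+x. f x \<partial>mX) * indicator (B t) u \<partial>mG)"
    by (simp add: nn_integral_multc nn_integral_action)
  also have "\<dots> = emeasure mG (B t) * (\<integral>\<^sup>+x. f x \<partial>mX)"
    by (simp add: nn_integral_cmult mult.commute)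
  finally show ?thesis .
qed

lemma ball_sum_translate:
  assumes [measurable]: "f \<in> borel_measurable borel" and t: "t > 0"
  shows "ball_sum f t (a (ginv h) x) = (\<integral>\<^sup>+u. f (a (ginv u) x) * indicator {u. d h u \<le> t} u \<partial>mG)"
proof -
  have [measurable]: "{u. d h u \<le> t} \<in> sets borel" using t by (rule left_ball)
  have "(\<integral>\<^sup>+u. f (a (ginv u) x) * indicator {u. d h u \<le> t} u \<partial>mG)
      = (\<integral>\<^sup>+u. f (a (ginv (mul h u)) x) * indicator {u. d h u \<le> t} (mul h u) \<partial>mG)"
    by (rule nn_integral_left_translation[symmetric]) measurable
  also have "\<dots> = ball_sum f t (a (ginv h) x)"
    using dist_left_inv[of h e]
    by (auto simp: ball_sum_def ginv_mul a_mul in_ball_iff indicator_def intro!: nn_integral_cong)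
  finally show ?thesis ..
qed

text \<open>The number \<open>R\<close> bounds the radii and is also the radius of the ball of base
  points \<open>h\<close> along an orbit, so the inequality on the group sees the ball of radius
  \<open>2 * R\<close>. Its measure exceeds that of \<open>B R\<close> by a factor at most
  \<open>C\<close>; the covering argument supplies the other factor.\<close>

lemma maximal_inequality_finite:
  assumes [measurable]: "f \<in> borel_measurable borel" and R: "R \<ge> (1::nat)"
  shows "L * emeasure mX {x. \<exists>n\<in>{1..R}. L * emeasure mG (B n) \<le> ball_sum f n x} \<le> ennreal (C\<^sup>2) * (\<integral>\<^sup>+x. f x \<partial>mX)"
proof -
  define D where "D = {x. \<exists>n\<in>{1..R}. L * emeasure mG (B n) \<le> ball_sum f n x}"
  have "D = (\<Union>n\<in>{1..R}. {x. L * emeasure mG (B n) \<le> ball_sum f n x})"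
    by (auto simp: D_def)
  also have "\<dots> \<in> sets borel"
  proof (intro sets.finite_UN)
    fix n assume "n \<in> {1..R}"
    then have [measurable]: "ball_sum f n \<in> borel_measurable borel" by simp
    show "{x. L * emeasure mG (B n) \<le> ball_sum f n x} \<in> sets borel" by measurable
  qed simp
  finally have [measurable]: "D \<in> sets borel" .
  have [measurable]: "B R \<in> sets borel" using R by (intro ball_measurable) simp
  \<comment> \<open>All translates of \<open>D\<close> have the measure of \<open>D\<close>. After
    Fubini, each \<open>x\<close> contributes the measure of those \<open>h\<close> in the ball
    whose orbit point lies in \<open>D\<close>.\<close>
  have "(L * emeasure mX D) * emeasure mG (B R) = L * (\<integral>\<^sup>+h. \<integral>\<^sup>+x. indicator (B R) h * indicator D (a (ginv h) x) \<partial>mX \<partial>mG)"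
    by (simp add: nn_integral_cmult nn_integral_action nn_integral_multc mult_ac)
  also have "\<dots> = L * (\<integral>\<^sup>+x. \<integral>\<^sup>+h. indicator (B R) h * indicator D (a (ginv h) x) \<partial>mG \<partial>mX)"
    by (subst XG.Fubini') measurable
  also have "\<dots> = (\<integral>\<^sup>+x. L * emeasure mG {h \<in> B R. a (ginv h) x \<in> D} \<partial>mX)"
  proof -
    have "(\<integral>\<^sup>+h. indicator (B R) h * indicator D (a (ginv h) x) \<partial>mG) = emeasure mG {h \<in> B R. a (ginv h) x \<in> D}" for x
    proof -
      have "(\<integral>\<^sup>+h. indicator (B R) h * indicator D (a (ginv h) x) \<partial>mG) = (\<integral>\<^sup>+h. indicator {h \<in> B R. a (ginv h) x \<in> D} h \<partial>mG)"
        by (intro nn_integral_cong) (auto simp: indicator_def)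
      also have "\<dots> = emeasure mG {h \<in> B R. a (ginv h) x \<in> D}"
        by (rule nn_integral_indicator) measurable
      finally show ?thesis .
    qed
    moreover have "(\<lambda>x. \<integral>\<^sup>+h. indicator (B R) h * indicator D (a (ginv h) x) \<partial>mG) \<in> borel_measurable mX"
      by measurable
    ultimately show ?thesis
      by (simp add: nn_integral_cmult)
  qed
  also have "\<dots> \<le> (\<integral>\<^sup>+x. C * ball_sum f (real R + real R) x \<partial>mX)"
  proof (rule nn_integral_mono)
    fix x
    show "L * emeasure mG {h \<in> B R. a (ginv h) x \<in> D} \<le> C * ball_sum f (real R + real R) x"
      unfolding ball_sum_def
    proof (rule maximal_inequality_group)
      fix h assume "h \<in> {h \<in> B R. a (ginv h) x \<in> D}"
      then show "\<exists>n\<in>{1..R}. L * emeasure mG (B n) \<le> (\<integral>\<^sup>+u. f (a (ginv u) x) * indicator {u. d h u \<le> real n} u \<partial>mG)"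
        by (force simp: D_def ball_sum_translate)
    qed (use R in \<open>auto\<close>)
  qed
  also have "\<dots> = C * (emeasure mG (B (2 * R)) * (\<integral>\<^sup>+x. f x \<partial>mX))"
    using R by (simp add: nn_integral_cmult nn_integral_ball_sum)
  also have "\<dots> \<le> C * ((C * emeasure mG (B R)) * (\<integral>\<^sup>+x. f x \<partial>mX))"
    using R doubling[of R] C_ge_1
    by (intro mult_left_mono mult_right_mono) (auto simp: emeasure_ball simp flip: ennreal_mult)
  also have "\<dots> = (ennreal (C\<^sup>2) * (\<integral>\<^sup>+x. f x \<partial>mX)) * emeasure mG (B R)"
    using C_ge_1 by (simp add: power2_eq_square ennreal_mult mult_ac)
  finally have "(L * emeasure mX D) * emeasure mG (B R) / emeasure mG (B R)
      \<le> (ennreal (C\<^sup>2) * (\<integral>\<^sup>+x. f x \<partial>mX)) * emeasure mG (B R) / emeasure mG (B R)"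
    by (rule divide_right_mono_ennreal)
  moreover have "emeasure mG (B R) \<noteq> 0" "emeasure mG (B R) \<noteq> \<infinity>"
    using R emeasure_ball_finite[of R] pos_balls[of R] by auto
  ultimately show ?thesis
    by (simp add: ennreal_mult_divide_eq D_def)
qed

text \<open>The constant of the finite version does not depend on \<open>R\<close>, so continuity
  from below gives all integer radii at once.\<close>

lemma maximal_inequality:
  assumes [measurable]: "f \<in> borel_measurable borel"
  shows "L * emeasure mX {x. \<exists>n\<ge>1::nat. L * emeasure mG (B n) \<le> ball_sum f n x}
    \<le> ennreal (C\<^sup>2) * (\<integral>\<^sup>+x. f x \<partial>mX)" (is "L * emeasure mX ?D \<le> _")
    and "{x. \<exists>n\<ge>1::nat. L * emeasure mG (B n) \<le> ball_sum f n x} \<in> sets borel"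
proof -
  \<comment> \<open>\<open>Suc R\<close> keeps the range of radii nonempty, as the finite version
    demands.\<close>
  define D where "D R = {x. \<exists>n\<in>{1..Suc R}. L * emeasure mG (B n) \<le> ball_sum f n x}" for R
  have D: "D R \<in> sets borel" for R
  proof -
    have "D R = (\<Union>n\<in>{1..Suc R}. {x. L * emeasure mG (B n) \<le> ball_sum f n x})"
      by (auto simp: D_def)
    also have "\<dots> \<in> sets borel"
    proof (intro sets.finite_UN)
      fix n assume "n \<in> {1..Suc R}"
      then have [measurable]: "ball_sum f n \<in> borel_measurable borel" by simp
      show "{x. L * emeasure mG (B n) \<le> ball_sum f n x} \<in> sets borel" by measurable
    qed simp
    finally show ?thesis .
  qed
  have U: "?D = (\<Union>R. D R)"
  proof (intro equalityI subsetI)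
    fix x assume "x \<in> ?D"
    then obtain n :: nat where n: "n \<ge> (1::nat)" "L * emeasure mG (B n) \<le> ball_sum f n x"
      unfolding mem_Collect_eq by (elim exE conjE)
    have "x \<in> D n" unfolding D_def mem_Collect_eq using n by (intro bexI[of _ n]) simp_all
    then show "x \<in> (\<Union>R. D R)" by (rule UN_I[OF UNIV_I])
  next
    fix x assume "x \<in> (\<Union>R. D R)"
    then obtain R where "x \<in> D R" by (rule UN_E)
    then obtain n where n: "n \<in> {1..Suc R}" "L * emeasure mG (B n) \<le> ball_sum f n x"
      unfolding D_def mem_Collect_eq by (rule bexE)
    then show "x \<in> ?D" unfolding mem_Collect_eq by (intro exI[of _ n] conjI) simp_all
  qed
  with D show "?D \<in> sets borel" by auto
  have "incseq D"
    unfolding incseq_def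
  proof (intro allI impI subsetI)
    fix m n :: nat and x assume "m \<le> n" "x \<in> D m"
    moreover from this have "{1..Suc m} \<subseteq> {1..Suc n}" by simp
    ultimately show "x \<in> D n" unfolding D_def mem_Collect_eq by (blast intro: bexI)
  qed
  then have "emeasure mX ?D = (SUP R. emeasure mX (D R))"
    unfolding U using D by (intro SUP_emeasure_incseq[symmetric]) auto
  then have "L * emeasure mX ?D = (SUP R. L * emeasure mX (D R))"
    by (simp add: SUP_mult_left_ennreal)
  also have "\<dots> \<le> ennreal (C\<^sup>2) * (\<integral>\<^sup>+x. f x \<partial>mX)"
    unfolding D_def by (intro SUP_least maximal_inequality_finite) auto
  finally show "L * emeasure mX ?D \<le> ennreal (C\<^sup>2) * (\<integral>\<^sup>+x. f x \<partial>mX)" .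
qed

section \<open>Ball averages and Banach's principle\<close>

abbreviation avg :: "real \<Rightarrow> ('x \<Rightarrow> real) \<Rightarrow> 'x \<Rightarrow> real" where
  "avg t f x \<equiv> ball_average ginv mG (B t) a f x"

abbreviation orbit_integrable :: "real \<Rightarrow> ('x \<Rightarrow> real) \<Rightarrow> 'x \<Rightarrow> bool" where
  "orbit_integrable t f x \<equiv> set_integrable mG (B t) (\<lambda>g. f (a (ginv g) x))"

lemma measurable_avg [measurable]:
  assumes [measurable]: "f \<in> borel_measurable borel" and "t > 0"
  shows "avg t f \<in> borel_measurable borel"
proof -
  have [measurable]: "B t \<in> sets borel" using assms(2) by (rule ball_measurable)
  have "avg t f \<in> borel_measurable mX"
    unfolding ball_average_def set_lebesgue_integral_def by measurable
  then show ?thesis by (simp add: measurable_mX)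
qed

text \<open>Valid on every orbit: where the function is not integrable, the Lebesgue integral is 0
  by convention and the bound is trivial.\<close>

lemma avg_abs_le_ball_sum:
  assumes t: "t > 0"
  shows "ennreal (\<bar>avg t f x\<bar> * measure mG (B t)) \<le> ball_sum (\<lambda>x. ennreal \<bar>f x\<bar>) t x"
proof -
  have "\<bar>avg t f x\<bar> * measure mG (B t) = norm (LINT g:B t|mG. f (a (ginv g) x))"
    using measure_ball_pos[OF t] by (simp add: ball_average_def abs_mult)
  also have "ennreal \<dots> \<le> (\<integral>\<^sup>+g. norm (indicator (B t) g *\<^sub>R f (a (ginv g) x)) \<partial>mG)"
    unfolding set_lebesgue_integral_def
  proof (cases "integrable mG (\<lambda>g. indicator (B t) g *\<^sub>R f (a (ginv g) x))")
    case True
    then show "ennreal (norm (\<integral>g. indicator (B t) g *\<^sub>R f (a (ginv g) x) \<partial>mG))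
        \<le> (\<integral>\<^sup>+g. norm (indicator (B t) g *\<^sub>R f (a (ginv g) x)) \<partial>mG)"
      by (rule integral_norm_bound_ennreal)
  next
    case False
    from not_integrable_integral_eq[OF this]
    show "ennreal (norm (\<integral>g. indicator (B t) g *\<^sub>R f (a (ginv g) x) \<partial>mG))
        \<le> (\<integral>\<^sup>+g. norm (indicator (B t) g *\<^sub>R f (a (ginv g) x)) \<partial>mG)"
      by (simp only: norm_zero ennreal_0 zero_le)
  qed
  also have "\<dots> = ball_sum (\<lambda>x. ennreal \<bar>f x\<bar>) t x"
    unfolding ball_sum_def by (intro nn_integral_cong) (simp add: indicator_def)
  finally show ?thesis .
qed

lemma orbit_integrable_iff:
  assumes [measurable]: "f \<in> borel_measurable borel" and t: "t > 0"
  shows "orbit_integrable t f x \<longleftrightarrow> ball_sum (\<lambda>x. ennreal \<bar>f x\<bar>) t x < \<infinity>"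
proof -
  have [measurable]: "B t \<in> sets borel" using t by (rule ball_measurable)
  have "ball_sum (\<lambda>x. ennreal \<bar>f x\<bar>) t x = (\<integral>\<^sup>+g. norm (indicator (B t) g *\<^sub>R f (a (ginv g) x)) \<partial>mG)"
    unfolding ball_sum_def by (intro nn_integral_cong) (simp add: indicator_def)
  moreover have "(\<lambda>g. indicator (B t) g *\<^sub>R f (a (ginv g) x)) \<in> borel_measurable mG"
    by measurable
  ultimately show ?thesis
    unfolding set_integrable_def by (simp add: integrable_iff_bounded)
qed

lemma orbit_integrable_bounded:
  assumes [measurable]: "f \<in> borel_measurable borel" and "\<And>x. \<bar>f x\<bar> \<le> M" and t: "t > 0"
  shows "orbit_integrable t f x"
proof -
  have [measurable]: "B t \<in> sets borel" using t by (rule ball_measurable)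
  show ?thesis
    unfolding set_integrable_def using emeasure_ball_finite[OF t] assms(2)
    by (intro integrableI_bounded_set[where A = "B t" and B = M]) (auto simp: indicator_def ball_measurable[OF t])
qed

text \<open>The null set must not depend on the radius. Countably many radii suffice, because
  integrability on a ball passes to smaller balls.\<close>

lemma AE_orbit_integrable:
  assumes f: "integrable mX f"
  shows "AE x in mX. \<forall>t>0. orbit_integrable t f x"
proof -
  have m [measurable]: "f \<in> borel_measurable borel"
    using borel_measurable_integrable[OF f] by (simp add: measurable_mX)
  have "AE x in mX. ball_sum (\<lambda>x. ennreal \<bar>f x\<bar>) (real n + 1) x \<noteq> \<infinity>" for n :: nat
  proof (rule nn_integral_PInf_AE)
    show "ball_sum (\<lambda>x. ennreal \<bar>f x\<bar>) (real n + 1) \<in> borel_measurable mX"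
      unfolding measurable_mX by (rule measurable_ball_sum) auto
    have "(\<integral>\<^sup>+x. ennreal \<bar>f x\<bar> \<partial>mX) < \<infinity>"
      using f by (simp add: integrable_iff_bounded)
    then show "(\<integral>\<^sup>+x. ball_sum (\<lambda>x. ennreal \<bar>f x\<bar>) (real n + 1) x \<partial>mX) \<noteq> \<infinity>"
      using emeasure_ball_finite[of "real n + 1"]
      by (subst nn_integral_ball_sum) (auto simp: ennreal_mult_eq_top_iff)
  qed
  then have "AE x in mX. \<forall>n::nat. ball_sum (\<lambda>x. ennreal \<bar>f x\<bar>) (real n + 1) x \<noteq> \<infinity>"
    by (simp add: AE_all_countable)
  then show ?thesis
  proof eventually_elim
    case (elim x)
    show ?case
    proof (intro allI impI)
      fix t :: real assume t: "t > 0"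
      obtain n :: nat where n: "t \<le> real n" using real_arch_simple by blast
      have "orbit_integrable (real n + 1) f x"
        using elim by (subst orbit_integrable_iff) (auto simp: less_top)
      then show "orbit_integrable t f x"
        using n by (rule_tac set_integrable_subset) (auto simp: ball_measurable[OF t] in_ball_iff)
    qed
  qed
qed

lemma avg_add:
  assumes "orbit_integrable t f x" "orbit_integrable t g x"
  shows "avg t (\<lambda>x. f x + g x) x = avg t f x + avg t g x"
  unfolding ball_average_def using assms by (simp add: set_integral_add ring_distribs)

lemma avg_diff:
  assumes "orbit_integrable t f x" "orbit_integrable t g x"
  shows "avg t (\<lambda>x. f x - g x) x = avg t f x - avg t g x"
  unfolding ball_average_def using assms by (simp add: set_integral_diff right_diff_distrib)

lemma avg_cmult: "avg t (\<lambda>x. c * f x) x = c * avg t f x"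
  unfolding ball_average_def by simp

lemma avg_const: "t > 0 \<Longrightarrow> avg t (\<lambda>_. c) x = c"
  using measure_ball_pos[of t] ball_measurable[of t] emeasure_ball_finite[of t]
  unfolding ball_average_def set_lebesgue_integral_def by simp

lemma avg_bounded:
  assumes "f \<in> borel_measurable borel" and M: "\<And>x. \<bar>f x\<bar> \<le> M" and t: "t > 0"
  shows "\<bar>avg t f x\<bar> \<le> M"
proof -
  have M0: "0 \<le> M" using M[of x] by linarith
  have "ennreal (\<bar>avg t f x\<bar> * measure mG (B t)) \<le> ball_sum (\<lambda>x. ennreal \<bar>f x\<bar>) t x"
    using t by (rule avg_abs_le_ball_sum)
  also have "\<dots> \<le> (\<integral>\<^sup>+u. ennreal M * indicator (B t) u \<partial>mG)"
    unfolding ball_sum_def using M by (intro nn_integral_mono mult_right_mono ennreal_leI) auto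
  also have "\<dots> = ennreal (M * measure mG (B t))"
    using M0 t by (simp add: nn_integral_cmult_indicator ball_measurable emeasure_ball ennreal_mult)
  finally show ?thesis
    using M0 measure_ball_pos[OF t] by (simp add: mult_le_cancel_right)
qed

text \<open>Passes from integer to real radii. For \<open>t\<close> at least 1 the next integer is
  at most \<open>2 * t\<close>, so enlarging the ball costs one factor \<open>C\<close>.\<close>

lemma avg_le_of_ball_sum_le:
  assumes L: "L > 0" and small: "\<And>n. n \<ge> (1::nat) \<Longrightarrow> \<not> ennreal L * emeasure mG (B n) \<le> ball_sum (\<lambda>x. ennreal \<bar>w x\<bar>) n x"
    and t: "t \<ge> 1"
  shows "\<bar>avg t w x\<bar> \<le> L * C"
proof -
  define n where "n = nat \<lceil>t\<rceil>"
  have n: "n \<ge> 1" "t \<le> real n" "real n \<le> 2 * t"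
    using t unfolding n_def by linarith+
  have "ennreal (\<bar>avg t w x\<bar> * measure mG (B t)) \<le> ball_sum (\<lambda>x. ennreal \<bar>w x\<bar>) t x"
    using t by (intro avg_abs_le_ball_sum) simp
  also have "\<dots> \<le> ball_sum (\<lambda>x. ennreal \<bar>w x\<bar>) n x"
    unfolding ball_sum_def using ball_mono[OF n(2)]
    by (intro nn_integral_mono mult_left_mono) (auto simp: indicator_def)
  also have "\<dots> \<le> ennreal L * emeasure mG (B n)"
    using small[OF n(1)] by simp
  also have "\<dots> = ennreal (L * measure mG (B n))"
    using n L by (simp add: emeasure_ball ennreal_mult)
  finally have "\<bar>avg t w x\<bar> * measure mG (B t) \<le> L * measure mG (B n)"
    using L by (simp add: ennreal_le_iff)
  also have "\<dots> \<le> L * measure mG (B (2 * t))"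
    using L n t by (intro mult_left_mono measure_ball_mono) auto
  also have "\<dots> \<le> L * (C * measure mG (B t))"
    using L t by (intro mult_left_mono doubling) auto
  finally have "\<bar>avg t w x\<bar> * measure mG (B t) \<le> (L * C) * measure mG (B t)"
    by (simp add: mult_ac)
  then show ?thesis
    using measure_ball_pos[of t] t by (simp add: mult_le_cancel_right)
qed

text \<open>Banach's principle: the maximal inequality makes the set of functions with convergent
  averages closed in \<open>L\<^sup>1\<close>.\<close>

lemma AE_avg_tendsto_0:
  assumes approx: "\<And>\<epsilon>. \<epsilon> > 0 \<Longrightarrow> \<exists>v w. integrable mX v \<and> integrable mX w \<and> u = (\<lambda>x. v x + w x) \<and>
      (AE x in mX. ((\<lambda>t. avg t v x) \<longlongrightarrow> 0) at_top) \<and> (\<integral>x. \<bar>w x\<bar> \<partial>mX) \<le> \<epsilon>"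
  shows "AE x in mX. ((\<lambda>t. avg t u x) \<longlongrightarrow> 0) at_top"
proof -
  have "\<forall>j::nat. \<exists>v w. integrable mX v \<and> integrable mX w \<and> u = (\<lambda>x. v x + w x) \<and>
      (AE x in mX. ((\<lambda>t. avg t v x) \<longlongrightarrow> 0) at_top) \<and> (\<integral>x. \<bar>w x\<bar> \<partial>mX) \<le> inverse (real (Suc j))"
    by (intro allI approx) simp
  then obtain v where "\<forall>j::nat. \<exists>w. integrable mX (v j) \<and> integrable mX w \<and> u = (\<lambda>x. v j x + w x) \<and>
      (AE x in mX. ((\<lambda>t. avg t (v j) x) \<longlongrightarrow> 0) at_top) \<and> (\<integral>x. \<bar>w x\<bar> \<partial>mX) \<le> inverse (real (Suc j))"
    by (rule choice[THEN exE])
  then obtain w where vw': "\<forall>j. integrable mX (v j) \<and> integrable mX (w j) \<and> u = (\<lambda>x. v j x + w j x) \<and>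
      (AE x in mX. ((\<lambda>t. avg t (v j) x) \<longlongrightarrow> 0) at_top) \<and> (\<integral>x. \<bar>w j x\<bar> \<partial>mX) \<le> inverse (real (Suc j))"
    by (rule choice[THEN exE])
  have vw: "\<And>j::nat. integrable mX (v j)" "\<And>j. integrable mX (w j)" "\<And>j. u = (\<lambda>x. v j x + w j x)"
    "\<And>j. AE x in mX. ((\<lambda>t. avg t (v j) x) \<longlongrightarrow> 0) at_top" "\<And>j. (\<integral>x. \<bar>w j x\<bar> \<partial>mX) \<le> inverse (real (Suc j))"
    using vw' by - (elim allE conjE, assumption)+
  have [measurable]: "w j \<in> borel_measurable borel" for j
    using borel_measurable_integrable[OF vw(2)[of j]] by (simp add: measurable_mX)
  have small: "AE x in mX. \<forall>\<^sub>F t in at_top. \<bar>avg t u x\<bar> < 2 * \<eta>" if "\<eta> > 0" for \<eta>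
  proof -
    \<comment> \<open>Chosen so that outside \<open>D j\<close> the averages of the error
      \<open>w j\<close> are bounded by \<open>L * C\<close>, which is \<eta>; the averages of
      \<open>v j\<close> account for the second \<eta>.\<close>
    define L where "L = \<eta> / C"
    have L: "L > 0" "L * C = \<eta>" using that C_ge_1 by (auto simp: L_def)
    define D where "D j = {x. \<exists>n\<ge>1::nat. ennreal L * emeasure mG (B n) \<le> ball_sum (\<lambda>x. ennreal \<bar>w j x\<bar>) n x}" for j
    have D [measurable]: "D j \<in> sets borel" for j
      unfolding D_def by (rule maximal_inequality) measurable
    have "L * measure mX (D j) \<le> C\<^sup>2 * inverse (real (Suc j))" for j
    proof -
      have "ennreal (L * measure mX (D j)) = ennreal L * emeasure mX (D j)"
        using L by (simp add: mX.emeasure_eq_measure ennreal_mult)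
      also have "\<dots> \<le> ennreal (C\<^sup>2) * (\<integral>\<^sup>+x. ennreal \<bar>w j x\<bar> \<partial>mX)"
        unfolding D_def by (rule maximal_inequality) measurable
      also have "(\<integral>\<^sup>+x. ennreal \<bar>w j x\<bar> \<partial>mX) = ennreal (\<integral>x. \<bar>w j x\<bar> \<partial>mX)"
        using vw(2) by (intro nn_integral_eq_integral) auto
      also have "ennreal (C\<^sup>2) * \<dots> \<le> ennreal (C\<^sup>2) * ennreal (inverse (real (Suc j)))"
        using vw(5)[of j] by (intro mult_left_mono ennreal_leI) auto
      also have "\<dots> = ennreal (C\<^sup>2 * inverse (real (Suc j)))"
        by (simp add: ennreal_mult)
      finally show ?thesis by (subst (asm) ennreal_le_iff) auto
    qed
    \<comment> \<open>A point is good as soon as it avoids one \<open>D j\<close>, so only the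
      intersection has to be null.\<close>
    moreover have "L * measure mX (\<Inter>j. D j) \<le> L * measure mX (D j)" for j
      using L by (intro mult_left_mono mX.finite_measure_mono) auto
    ultimately have le: "L * measure mX (\<Inter>j. D j) \<le> C\<^sup>2 * inverse (real (Suc j))" for j
      using order_trans by blast
    have "L * measure mX (\<Inter>j. D j) \<le> C\<^sup>2 * 0"
      using le by (intro LIMSEQ_le_const[OF tendsto_mult[OF tendsto_const LIMSEQ_inverse_real_of_nat]]) auto
    then have "measure mX (\<Inter>j. D j) = 0"
      using L by (simp add: mult_le_0_iff measure_le_0_iff)
    then have "(\<Inter>j. D j) \<in> null_sets mX"
      by (simp add: null_sets_def mX.emeasure_eq_measure)
    then have "AE x in mX. x \<notin> (\<Inter>j. D j)"
      by (rule AE_not_in)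
    moreover have "AE x in mX. \<forall>j. ((\<lambda>t. avg t (v j) x) \<longlongrightarrow> 0) at_top"
      using vw(4) by (simp add: AE_all_countable)
    moreover have "AE x in mX. \<forall>j. \<forall>t>0. orbit_integrable t (v j) x"
      using vw(1) AE_orbit_integrable by (simp add: AE_all_countable)
    moreover have "AE x in mX. \<forall>j. \<forall>t>0. orbit_integrable t (w j) x"
      using vw(2) AE_orbit_integrable by (simp add: AE_all_countable)
    ultimately show ?thesis
    proof eventually_elim
      case (elim x)
      then obtain j where j: "x \<notin> D j" by blast
      have "\<forall>\<^sub>F t in at_top. \<bar>avg t (v j) x\<bar> < \<eta>"
        using elim(2) \<open>\<eta> > 0\<close> by (auto simp: tendsto_iff dist_real_def)
      then show ?case
        using eventually_ge_at_top[of 1]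
      proof eventually_elim
        case t: (elim t)
        have "avg t u x = avg t (v j) x + avg t (w j) x"
          using elim(3,4) t(2) by (subst vw(3)[of j], intro avg_add) auto
        moreover have "\<bar>avg t (w j) x\<bar> \<le> L * C"
          using j L(1) t(2) unfolding D_def by (intro avg_le_of_ball_sum_le) auto
        ultimately show ?case using t(1) L(2) by linarith
      qed
    qed
  qed
  \<comment> \<open>Countably many thresholds, so that one null set serves them all.\<close>
  have "AE x in mX. \<forall>k::nat. \<forall>\<^sub>F t in at_top. \<bar>avg t u x\<bar> < 2 * inverse (real (Suc k))"
    unfolding AE_all_countable by (intro allI small) simp
  then show ?thesis
  proof eventually_elim
    case (elim x)
    show ?case
    proof (rule tendstoI)
      fix \<epsilon> :: real assume "\<epsilon> > 0"
      then obtain k where "inverse (real (Suc k)) < \<epsilon> / 2"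
        using reals_Archimedean[of "\<epsilon> / 2"] by auto
      with elim show "\<forall>\<^sub>F t in at_top. dist (avg t u x) 0 < \<epsilon>"
        by (auto simp: dist_real_def elim!: allE[of _ k] eventually_mono)
    qed
  qed
qed

section \<open>Asymptotic invariance of the averages of bounded functions\<close>

lemma indicator_integral_diff:
  fixes \<psi> :: "'g \<Rightarrow> real"
  assumes [measurable]: "\<psi> \<in> borel_measurable borel" and M: "\<And>u. \<bar>\<psi> u\<bar> \<le> M"
    and S: "S \<in> fmeasurable mG" and T: "T \<in> fmeasurable mG"
  shows "\<bar>(LINT u:S|mG. \<psi> u) - (LINT u:T|mG. \<psi> u)\<bar> \<le> M * measure mG (symdiff S T)"
proof -
  have M0: "0 \<le> M" using M[of undefined] by linarith
  have ST: "symdiff S T \<in> fmeasurable mG"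
    unfolding symdiff_def using S T by (intro fmeasurable.Un fmeasurable.Diff)
  have int: "integrable mG (\<lambda>u. indicator A u *\<^sub>R \<psi> u)" if "A \<in> fmeasurable mG" for A
    using that M by (intro integrableI_bounded_set[where A = A and B = M])
      (auto simp: fmeasurable_def indicator_def less_top)
  have "(LINT u:S|mG. \<psi> u) - (LINT u:T|mG. \<psi> u) = (\<integral>u. indicator S u *\<^sub>R \<psi> u - indicator T u *\<^sub>R \<psi> u \<partial>mG)"
    unfolding set_lebesgue_integral_def using int S T by simp
  also have "\<bar>\<dots>\<bar> \<le> (\<integral>u. \<bar>indicator S u *\<^sub>R \<psi> u - indicator T u *\<^sub>R \<psi> u\<bar> \<partial>mG)"
    by (rule integral_abs_bound)
  also have "\<dots> \<le> (\<integral>u. M * indicator (symdiff S T) u \<partial>mG)"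
  proof (rule integral_mono)
    show "integrable mG (\<lambda>u. M * indicator (symdiff S T) u)"
      using ST by (simp add: fmeasurable_def)
  qed (use int S T M M0 in \<open>auto simp: indicator_def symdiff_def\<close>)
  also have "\<dots> = M * measure mG (symdiff S T)"
    using ST by (simp add: fmeasurable_def)
  finally show ?thesis .
qed

text \<open>Since \<open>a h (a (ginv g) x)\<close> is \<open>a (ginv (mul g (ginv h))) x\<close>,
  the shifted average integrates the same orbit function over the right translate of the ball by
  \<open>ginv h\<close>. The change of variables uses right invariance of the measure.\<close>

lemma avg_comp_action_tendsto:
  assumes [measurable]: "f \<in> borel_measurable borel" and M: "\<And>x. \<bar>f x\<bar> \<le> M"
  shows "((\<lambda>t. avg t (\<lambda>x. f (a h x)) x - avg t f x) \<longlongrightarrow> 0) at_top"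
proof (rule Lim_null_comparison)
  show "((\<lambda>t. M * (measure mG (symdiff ((\<lambda>g. mul g (ginv h)) ` B t) (B t)) / measure mG (B t))) \<longlongrightarrow> 0) at_top"
    by (rule tendsto_mult_right_zero[OF asymp_inv])
  show "\<forall>\<^sub>F t in at_top. norm (avg t (\<lambda>x. f (a h x)) x - avg t f x)
      \<le> M * (measure mG (symdiff ((\<lambda>g. mul g (ginv h)) ` B t) (B t)) / measure mG (B t))"
    using eventually_gt_at_top[of 0]
  proof eventually_elim
    case (elim t)
    note [measurable] = ball_measurable[OF elim]
    let ?S = "(\<lambda>g. mul g (ginv h)) ` B t" and ?\<psi> = "\<lambda>u. f (a (ginv u) x)"
    have [measurable]: "?S \<in> sets borel" using elim by (rule right_translate_ball)
    have "(LINT u:?S|mG. ?\<psi> u) = (\<integral>u. indicator ?S u *\<^sub>R ?\<psi> u \<partial>distr mG mG (\<lambda>u. mul u (ginv h)))"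
      by (simp add: set_lebesgue_integral_def distr_right_translation)
    also have "\<dots> = (\<integral>g. indicator ?S (mul g (ginv h)) *\<^sub>R ?\<psi> (mul g (ginv h)) \<partial>mG)"
      by (rule integral_distr) measurable
    also have "\<dots> = (LINT g:B t|mG. f (a h (a (ginv g) x)))"
      unfolding set_lebesgue_integral_def
      by (intro Bochner_Integration.integral_cong)
        (auto simp: right_translate_eq mul_assoc ginv_mul a_mul indicator_def)
    finally have "\<bar>(LINT g:B t|mG. f (a h (a (ginv g) x))) - (LINT u:B t|mG. ?\<psi> u)\<bar> \<le> M * measure mG (symdiff ?S (B t))"
      using indicator_integral_diff[of ?\<psi> M ?S "B t"] M right_translate_ball_fmeasurable[OF elim] by simp
    then show ?case
      using measure_ball_pos[OF elim]
      by (simp add: ball_average_def divide_right_mono abs_divide flip: diff_divide_distrib)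
  qed
qed

lemma in_ball_ginv [simp]: "ginv g \<in> B t \<longleftrightarrow> g \<in> B t"
  using dist_e_mul[of g e] dist_sym[of g e] by (simp add: in_ball_iff)

text \<open>Inversion preserves the measure, fixes the ball and carries its left translate by
  \<open>ginv h\<close> to its right translate by \<open>h\<close>. This converts the right-sided
  hypothesis into a left-sided one.\<close>

lemma measure_symdiff_left_translate:
  assumes "t > 0"
  shows "measure mG (symdiff {u. mul h u \<in> B t} (B t)) = measure mG (symdiff ((\<lambda>g. mul g h) ` B t) (B t))"
proof -
  note [measurable] = ball_measurable[OF assms]
  have S [measurable]: "symdiff {u. mul h u \<in> B t} (B t) \<in> sets borel"
    unfolding symdiff_def by measurable
  have S' [measurable]: "symdiff ((\<lambda>g. mul g h) ` B t) (B t) \<in> sets borel"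
    unfolding symdiff_def using right_translate_ball[OF assms] by measurable
  have "mul h (ginv u) \<in> B t \<longleftrightarrow> mul u (ginv h) \<in> B t" for u
    using in_ball_ginv[of "mul h (ginv u)" t] by (simp add: ginv_mul)
  then have "indicator (symdiff {u. mul h u \<in> B t} (B t)) (ginv u)
      = (indicator (symdiff ((\<lambda>g. mul g h) ` B t) (B t)) u :: ennreal)" for u
    by (simp add: right_translate_eq symdiff_def indicator_def)
  then have "emeasure mG (symdiff {u. mul h u \<in> B t} (B t)) = emeasure mG (symdiff ((\<lambda>g. mul g h) ` B t) (B t))"
    using nn_integral_inverse[of "indicator (symdiff {u. mul h u \<in> B t} (B t))"] S S' by simp
  then show ?thesis by (simp add: measure_def)
qed

text \<open>Here the ball is replaced by its left translate by \<open>ginv h\<close>. The limit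
  holds at every \<open>x\<close>, so limits of averages will be invariant everywhere.\<close>

lemma avg_at_action_tendsto:
  assumes [measurable]: "f \<in> borel_measurable borel" and M: "\<And>x. \<bar>f x\<bar> \<le> M"
  shows "((\<lambda>t. avg t f (a h x) - avg t f x) \<longlongrightarrow> 0) at_top"
proof (rule Lim_null_comparison)
  show "((\<lambda>t. M * (measure mG (symdiff ((\<lambda>g. mul g h) ` B t) (B t)) / measure mG (B t))) \<longlongrightarrow> 0) at_top"
    by (rule tendsto_mult_right_zero[OF asymp_inv])
  show "\<forall>\<^sub>F t in at_top. norm (avg t f (a h x) - avg t f x)
      \<le> M * (measure mG (symdiff ((\<lambda>g. mul g h) ` B t) (B t)) / measure mG (B t))"
    using eventually_gt_at_top[of 0]
  proof eventually_elim
    case (elim t)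
    note [measurable] = ball_measurable[OF elim]
    let ?S = "{u. mul h u \<in> B t}" and ?\<psi> = "\<lambda>u. f (a (ginv u) x)"
    have S: "?S = {u. d (ginv h) u \<le> t}"
      using dist_e_mul[of "ginv h"] by (simp add: in_ball_iff)
    have fS: "?S \<in> fmeasurable mG"
      unfolding S fmeasurable_def using left_ball[OF elim] emeasure_ball_finite[OF elim] by simp
    then have [measurable]: "?S \<in> sets borel" by (auto simp: fmeasurable_def)
    have "(LINT u:?S|mG. ?\<psi> u) = (\<integral>u. indicator ?S u *\<^sub>R ?\<psi> u \<partial>distr mG mG (mul (ginv h)))"
      by (simp add: set_lebesgue_integral_def distr_left_translation)
    also have "\<dots> = (\<integral>g. indicator ?S (mul (ginv h) g) *\<^sub>R ?\<psi> (mul (ginv h) g) \<partial>mG)"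
      by (rule integral_distr) measurable
    also have "\<dots> = (LINT g:B t|mG. f (a (ginv g) (a h x)))"
      unfolding set_lebesgue_integral_def
      by (intro Bochner_Integration.integral_cong) (auto simp: ginv_mul a_mul indicator_def)
    finally have "\<bar>(LINT g:B t|mG. f (a (ginv g) (a h x))) - (LINT u:B t|mG. ?\<psi> u)\<bar>
        \<le> M * measure mG (symdiff ((\<lambda>g. mul g h) ` B t) (B t))"
      using indicator_integral_diff[of ?\<psi> M ?S "B t"] M fS right_translate_ball_fmeasurable(2)[OF elim]
      by (simp add: measure_symdiff_left_translate[OF elim])
    then show ?case
      using measure_ball_pos[OF elim]
      by (simp add: ball_average_def divide_right_mono abs_divide flip: diff_divide_distrib)
  qed
qed

section \<open>The mean ergodic theorem for bounded functions\<close>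

lemma prob_UNIV [simp]: "measure mX UNIV = 1" "emeasure mX UNIV = 1"
  using mX.prob_space mX.emeasure_space_1 by simp_all

lemma integrable_bounded:
  assumes "f \<in> borel_measurable borel" and "\<And>x. \<bar>f x\<bar> \<le> (M::real)"
  shows "integrable mX f"
  using assms by (intro mX.integrable_const_bound[where B = M]) (auto simp: measurable_mX)

lemma integral_action:
  fixes f :: "'x \<Rightarrow> real"
  assumes [measurable]: "f \<in> borel_measurable borel"
  shows "(\<integral>x. f (a g x) \<partial>mX) = (\<integral>x. f x \<partial>mX)"
proof -
  have "(\<integral>x. f x \<partial>distr mX mX (a g)) = (\<integral>x. f (a g x) \<partial>mX)"
    by (rule integral_distr) measurable
  then show ?thesis by (simp add: distr_action)
qed

lemma integral_avg:
  assumes [measurable]: "f \<in> borel_measurable borel" and M: "\<And>x. \<bar>f x\<bar> \<le> M" and t: "t > 0"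
  shows "(\<integral>x. avg t f x \<partial>mX) = (\<integral>x. f x \<partial>mX)"
proof -
  note [measurable] = ball_measurable[OF t]
  have "integrable (mX \<Otimes>\<^sub>M mG) (\<lambda>(x, u). indicator (B t) u *\<^sub>R f (a (ginv u) x))"
  proof (rule integrableI_bounded_set[where A = "UNIV \<times> B t" and B = M])
    show "emeasure (mX \<Otimes>\<^sub>M mG) (UNIV \<times> B t) < \<infinity>"
      using emeasure_ball_finite[OF t] mX.emeasure_space_1
      by (subst mG.emeasure_pair_measure_Times) auto
  qed (use M in \<open>auto simp: indicator_def\<close>)
  then have "(\<integral>x. \<integral>u. indicator (B t) u *\<^sub>R f (a (ginv u) x) \<partial>mG \<partial>mX)
      = (\<integral>u. \<integral>x. indicator (B t) u *\<^sub>R f (a (ginv u) x) \<partial>mX \<partial>mG)"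
    by (rule XG.Fubini_integral[symmetric])
  also have "\<dots> = measure mG (B t) * (\<integral>x. f x \<partial>mX)"
    by (simp add: integral_action)
  finally show ?thesis
    using measure_ball_pos[OF t] by (simp add: ball_average_def set_lebesgue_integral_def)
qed

text \<open>Only the level sets at the mean matter: if \<open>F\<close> were below its mean on a set
  of measure 1, its integral would be strictly smaller than itself, so by the zero-one alternative
  that set is null. The same holds above the mean.\<close>

lemma ergodic_invariant_AE_const:
  fixes F :: "'x \<Rightarrow> real"
  assumes erg: "ergodic_action a mX" and F: "integrable mX F" and inv: "\<And>g x. F (a g x) = F x"
  shows "AE x in mX. F x = (\<integral>x. F x \<partial>mX)"
proof -
  let ?c = "\<integral>x. F x \<partial>mX"
  have [measurable]: "F \<in> borel_measurable borel"
    using borel_measurable_integrable[OF F] by (simp add: measurable_mX)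
  have zero_one: "measure mX {x. P (F x)} = 0 \<or> measure mX {x. P (F x)} = 1"
    if "{x. P (F x)} \<in> sets borel" for P
    using erg that unfolding ergodic_action_def by (auto simp: inv dest!: bspec[of _ _ "{x. P (F x)}"])
  have 1: "AE x in mX. \<not> F x < ?c"
  proof -
    have m: "{x. F x < ?c} \<in> sets borel" by measurable
    have "measure mX {x. F x < ?c} \<noteq> 1"
    proof
      assume "measure mX {x. F x < ?c} = 1"
      then have "AE x in mX. F x < ?c"
        using mX.AE_prob_1[of "{x. F x < ?c}"] by simp
      then have "?c < (\<integral>x. ?c \<partial>mX)"
        using F by (intro mX.integral_less_AE_space) (auto simp: mX.emeasure_space_1)
      then show False by (simp add: mX.prob_space)
    qed
    then have "measure mX {x. F x < ?c} = 0" using zero_one[OF m] by blast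
    then show ?thesis using m by (subst (asm) mX.prob_eq_0) auto
  qed
  have 2: "AE x in mX. \<not> F x > ?c"
  proof -
    have m: "{x. F x > ?c} \<in> sets borel" by measurable
    have "measure mX {x. F x > ?c} \<noteq> 1"
    proof
      assume "measure mX {x. F x > ?c} = 1"
      then have "AE x in mX. ?c < F x"
        using mX.AE_prob_1[of "{x. F x > ?c}"] by simp
      then have "(\<integral>x. ?c \<partial>mX) < ?c"
        using F by (intro mX.integral_less_AE_space) (auto simp: mX.emeasure_space_1)
      then show False by (simp add: mX.prob_space)
    qed
    then have "measure mX {x. F x > ?c} = 0" using zero_one[OF m] by blast
    then show ?thesis using m by (subst (asm) mX.prob_eq_0) auto
  qed
  from 1 2 show ?thesis by eventually_elim linarith
qed

text \<open>This set replaces the convex hull of the translates of \<open>f\<close> in the mean ergodic theorem: it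
  contains \<open>f\<close> and is closed under translations and midpoints.\<close>

definition equiaverage :: "('x \<Rightarrow> real) \<Rightarrow> real \<Rightarrow> ('x \<Rightarrow> real) set" where
  "equiaverage f M = {g \<in> borel_measurable borel. (\<forall>x. \<bar>g x\<bar> \<le> M) \<and>
     (\<forall>x. ((\<lambda>t. avg t g x - avg t f x) \<longlongrightarrow> 0) at_top)}"

lemma equiaverageD:
  assumes "g \<in> equiaverage f M"
  shows "g \<in> borel_measurable borel" "\<bar>g x\<bar> \<le> M" "((\<lambda>t. avg t g x - avg t f x) \<longlongrightarrow> 0) at_top"
  using assms by (auto simp: equiaverage_def)

lemma equiaverage_translate:
  assumes g: "g \<in> equiaverage f M"
  shows "(\<lambda>x. g (a h x)) \<in> equiaverage f M"
proof -
  note [measurable] = equiaverageD(1)[OF g]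
  have "((\<lambda>t. avg t (\<lambda>x. g (a h x)) x - avg t f x) \<longlongrightarrow> 0) at_top" for x
    using tendsto_add[OF avg_comp_action_tendsto[OF equiaverageD(1,2)[OF g], of h x] equiaverageD(3)[OF g, of x]] by simp
  moreover have "(\<lambda>x. g (a h x)) \<in> borel_measurable borel" by measurable
  ultimately show ?thesis
    using equiaverageD(2)[OF g] by (simp add: equiaverage_def)
qed

lemma equiaverage_midpoint:
  assumes g: "g \<in> equiaverage f M" and g': "g' \<in> equiaverage f M"
  shows "(\<lambda>x. 1/2 * (g x + g' x)) \<in> equiaverage f M"
proof -
  note [measurable] = equiaverageD(1)[OF g] equiaverageD(1)[OF g']
  have "((\<lambda>t. avg t (\<lambda>x. 1/2 * (g x + g' x)) x - avg t f x) \<longlongrightarrow> 0) at_top" for x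
  proof (rule Lim_transform_eventually)
    show "((\<lambda>t. 1/2 * ((avg t g x - avg t f x) + (avg t g' x - avg t f x))) \<longlongrightarrow> 0) at_top"
      by (intro tendsto_mult_right_zero tendsto_add_zero equiaverageD(3)[OF g] equiaverageD(3)[OF g'])
    show "\<forall>\<^sub>F t in at_top. 1/2 * ((avg t g x - avg t f x) + (avg t g' x - avg t f x))
        = avg t (\<lambda>x. 1/2 * (g x + g' x)) x - avg t f x"
      using eventually_gt_at_top[of 0]
    proof eventually_elim
      case (elim t)
      have "avg t (\<lambda>x. g x + g' x) x = avg t g x + avg t g' x"
        using elim g g' by (intro avg_add orbit_integrable_bounded[where M = M]) (auto dest: equiaverageD)
      then have "avg t (\<lambda>x. 1/2 * (g x + g' x)) x = 1/2 * (avg t g x + avg t g' x)"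
        by (simp only: avg_cmult)
      then show ?case by (simp add: field_simps)
    qed
  qed
  moreover have "\<bar>1/2 * (g x + g' x)\<bar> \<le> M" for x
    using equiaverageD(2)[OF g, of x] equiaverageD(2)[OF g', of x] by (simp add: abs_le_iff)
  moreover have "(\<lambda>x. 1/2 * (g x + g' x)) \<in> borel_measurable borel" by measurable
  ultimately show ?thesis
    unfolding equiaverage_def by blast
qed

text \<open>By the parallelogram law, an element of almost minimal \<open>L\<^sup>2\<close> norm is almost invariant.\<close>

lemma exists_almost_invariant:
  assumes f: "f \<in> borel_measurable borel" "\<And>x. \<bar>f x\<bar> \<le> M" and \<epsilon>: "\<epsilon> > 0"
  shows "\<exists>g\<in>equiaverage f M. \<forall>h. (\<integral>x. \<bar>g (a h x) - g x\<bar> \<partial>mX) \<le> \<epsilon>"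
proof -
  define I where "I g = (\<integral>x. (g x)\<^sup>2 \<partial>mX)" for g :: "'x \<Rightarrow> real"
  define c where "c = (INF g\<in>equiaverage f M. I g)"
  have bdd: "bdd_below (I ` equiaverage f M)"
    by (intro bdd_belowI2[where m = 0]) (simp add: I_def)
  have "f \<in> equiaverage f M" using f by (simp add: equiaverage_def)
  then have ne: "equiaverage f M \<noteq> {}" by blast
  \<comment> \<open>The parallelogram law bounds the squared distance of \<open>g\<close> to its
    translate by four times the excess of \<open>I g\<close> over \<open>c\<close>, since the
    translate has the same norm and the midpoint has at least \<open>c\<close>.\<close>
  have "c < c + \<epsilon>\<^sup>2 / 4" using \<epsilon> by simp
  then obtain g where g: "g \<in> equiaverage f M" "I g < c + \<epsilon>\<^sup>2 / 4"
    using cINF_less_iff[OF ne bdd] unfolding c_def by blast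
  have [measurable]: "g \<in> borel_measurable borel" using g(1) by (rule equiaverageD)
  have "(\<integral>x. \<bar>g (a h x) - g x\<bar> \<partial>mX) \<le> \<epsilon>" for h
  proof -
    let ?g' = "\<lambda>x. g (a h x)" and ?m = "\<lambda>x. 1/2 * (g x + g (a h x))"
    have g': "?g' \<in> equiaverage f M" using g(1) by (rule equiaverage_translate)
    have m: "?m \<in> equiaverage f M" using g(1) g' by (rule equiaverage_midpoint)
    have int: "integrable mX (\<lambda>x. (k x)\<^sup>2)" if k: "k \<in> equiaverage f M" for k
    proof (rule integrable_bounded)
      show "\<bar>(k x)\<^sup>2\<bar> \<le> M\<^sup>2" for x
        using equiaverageD(2)[OF k, of x] power_mono[of "\<bar>k x\<bar>" M 2] by simp
      show "(\<lambda>x. (k x)\<^sup>2) \<in> borel_measurable borel"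
        using equiaverageD(1)[OF k] by measurable
    qed
    have "c \<le> I ?m" unfolding c_def using bdd m by (rule cINF_lower)
    moreover have "I ?g' = I g"
      unfolding I_def using integral_action[of "\<lambda>x. (g x)\<^sup>2" h] by simp
    moreover have eq: "(g (a h x) - g x)\<^sup>2 = 2 * (g x)\<^sup>2 + 2 * (g (a h x))\<^sup>2 - 4 * (1/2 * (g x + g (a h x)))\<^sup>2" for x
      by (simp add: power2_eq_square field_simps)
    have "(\<integral>x. (g (a h x) - g x)\<^sup>2 \<partial>mX) = 2 * I g + 2 * I ?g' - 4 * I ?m"
      unfolding eq I_def using int[OF g(1)] int[OF g'] int[OF m] by simp
    ultimately have sq: "(\<integral>x. (g (a h x) - g x)\<^sup>2 \<partial>mX) \<le> \<epsilon>\<^sup>2"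
      using g(2) by simp
    have int_sq: "integrable mX (\<lambda>x. (g (a h x) - g x)\<^sup>2)"
      unfolding eq using int[OF g(1)] int[OF g'] int[OF m] by simp
    \<comment> \<open>Takes the place of Cauchy-Schwarz in passing to the first power: after
      integration each of the two terms contributes at most half of \<epsilon>.\<close>
    have ab: "\<bar>y\<bar> \<le> (1 / (2 * \<epsilon>)) * y\<^sup>2 + \<epsilon> / 2" for y :: real
    proof -
      have "0 \<le> (\<bar>y\<bar> - \<epsilon>)\<^sup>2" by simp
      then have "2 * \<epsilon> * \<bar>y\<bar> \<le> y\<^sup>2 + \<epsilon>\<^sup>2" by (simp add: power2_diff mult_ac)
      then show ?thesis using \<epsilon> by (simp add: field_simps power2_eq_square)
    qed
    have "(\<integral>x. \<bar>g (a h x) - g x\<bar> \<partial>mX) \<le> (\<integral>x. (1 / (2 * \<epsilon>)) * (g (a h x) - g x)\<^sup>2 + \<epsilon> / 2 \<partial>mX)"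
    proof (rule integral_mono)
      show "integrable mX (\<lambda>x. \<bar>g (a h x) - g x\<bar>)"
        by (intro integrable_abs Bochner_Integration.integrable_diff
            integrable_bounded[OF equiaverageD(1,2)[OF g(1)]] integrable_bounded[OF equiaverageD(1,2)[OF g']])
      show "integrable mX (\<lambda>x. (1 / (2 * \<epsilon>)) * (g (a h x) - g x)\<^sup>2 + \<epsilon> / 2)"
        using int_sq by simp
    qed (rule ab)
    also have "\<dots> = (1 / (2 * \<epsilon>)) * (\<integral>x. (g (a h x) - g x)\<^sup>2 \<partial>mX) + \<epsilon> / 2"
      using int_sq by (simp add: mX.prob_space)
    also have "\<dots> \<le> (1 / (2 * \<epsilon>)) * \<epsilon>\<^sup>2 + \<epsilon> / 2"
      using sq \<epsilon> by (intro add_right_mono mult_left_mono) auto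
    also have "\<dots> = \<epsilon>" using \<epsilon> by (simp add: power2_eq_square)
    finally show ?thesis .
  qed
  with g(1) show ?thesis by blast
qed

text \<open>The difference is itself an average of \<open>g (a (ginv u) x) - g x\<close> over the
  ball, each of small norm by hypothesis; Fubini gives a bound uniform in \<open>t\<close>.\<close>

lemma avg_near_almost_invariant:
  assumes g [measurable]: "g \<in> borel_measurable borel" and M: "\<And>x. \<bar>g x\<bar> \<le> M"
    and near: "\<And>h. (\<integral>x. \<bar>g (a h x) - g x\<bar> \<partial>mX) \<le> \<epsilon>" and t: "t > 0"
  shows "(\<integral>x. \<bar>avg t g x - g x\<bar> \<partial>mX) \<le> \<epsilon>"
proof -
  note [measurable] = ball_measurable[OF t]
  have [measurable]: "avg t g \<in> borel_measurable borel" using g t by (rule measurable_avg)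
  have \<epsilon>: "0 \<le> \<epsilon>" using near[of e] by simp
  have int: "integrable mX (\<lambda>x. \<bar>g (a h x) - g x\<bar>)" for h
  proof (rule integrable_bounded)
    show "\<bar>\<bar>g (a h x) - g x\<bar>\<bar> \<le> 2 * M" for x using M[of x] M[of "a h x"] by linarith
  qed measurable
  have int': "integrable mX (\<lambda>x. \<bar>avg t g x - g x\<bar>)"
  proof (rule integrable_bounded)
    show "\<bar>\<bar>avg t g x - g x\<bar>\<bar> \<le> 2 * M" for x using M[of x] avg_bounded[OF g M t, of x] by linarith
  qed measurable
  have "ennreal (\<integral>x. \<bar>avg t g x - g x\<bar> \<partial>mX) * emeasure mG (B t)
      = (\<integral>\<^sup>+x. ennreal \<bar>avg t g x - g x\<bar> * emeasure mG (B t) \<partial>mX)"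
    using int' by (subst nn_integral_multc) (auto simp: nn_integral_eq_integral)
  also have "\<dots> \<le> (\<integral>\<^sup>+x. \<integral>\<^sup>+u. ennreal \<bar>g (a (ginv u) x) - g x\<bar> * indicator (B t) u \<partial>mG \<partial>mX)"
  proof (rule nn_integral_mono)
    fix x
    \<comment> \<open>The value \<open>g x\<close> is a constant here, and a constant is its own
      average.\<close>
    have "avg t (\<lambda>y. g y - g x) x = avg t g x - avg t (\<lambda>_. g x) x"
      using M by (intro avg_diff orbit_integrable_bounded[where M = M] t) auto
    then have "avg t (\<lambda>y. g y - g x) x = avg t g x - g x"
      using t by (simp add: avg_const)
    then show "ennreal \<bar>avg t g x - g x\<bar> * emeasure mG (B t)
        \<le> (\<integral>\<^sup>+u. ennreal \<bar>g (a (ginv u) x) - g x\<bar> * indicator (B t) u \<partial>mG)"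
      using avg_abs_le_ball_sum[OF t, of "\<lambda>y. g y - g x" x] t
      by (simp add: ball_sum_def emeasure_ball ennreal_mult)
  qed
  also have "\<dots> = (\<integral>\<^sup>+u. \<integral>\<^sup>+x. ennreal \<bar>g (a (ginv u) x) - g x\<bar> * indicator (B t) u \<partial>mX \<partial>mG)"
    by (rule XG.Fubini'[symmetric]) measurable
  also have "\<dots> \<le> (\<integral>\<^sup>+u. ennreal \<epsilon> * indicator (B t) u \<partial>mG)"
  proof (rule nn_integral_mono)
    fix u
    have "(\<integral>\<^sup>+x. ennreal \<bar>g (a (ginv u) x) - g x\<bar> \<partial>mX) \<le> ennreal \<epsilon>"
      using int[of "ginv u"] near[of "ginv u"] by (simp add: nn_integral_eq_integral ennreal_leI)
    then show "(\<integral>\<^sup>+x. ennreal \<bar>g (a (ginv u) x) - g x\<bar> * indicator (B t) u \<partial>mX) \<le> ennreal \<epsilon> * indicator (B t) u"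
      by (subst nn_integral_multc) (auto intro: mult_right_mono)
  qed
  also have "\<dots> = ennreal \<epsilon> * emeasure mG (B t)"
    by (simp add: nn_integral_cmult_indicator)
  finally have "(\<integral>x. \<bar>avg t g x - g x\<bar> \<partial>mX) * measure mG (B t) \<le> \<epsilon> * measure mG (B t)"
    using \<epsilon> t by (simp add: emeasure_ball flip: ennreal_mult)
  then show ?thesis
    using measure_ball_pos[OF t] by (simp add: mult_le_cancel_right)
qed

end

section \<open>Convergence of the averages of bounded functions to the mean\<close>

lemma filterlim_Suc_at_top: "filterlim (\<lambda>n. real (Suc n)) at_top sequentially"
  by (rule filterlim_at_top_mono[OF filterlim_real_sequentially]) simp

context doubling_group_action
begin

text \<open>Pointwise asymptotic equality becomes convergence in norm by dominated convergence, both
  averages being bounded by \<open>M\<close>. The radii \<open>Suc n\<close> avoid the radius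
  0.\<close>

lemma equiaverage_L1_tendsto:
  assumes f: "f \<in> borel_measurable borel" "\<And>x. \<bar>f x\<bar> \<le> M" and g: "g \<in> equiaverage f M"
  shows "(\<lambda>n. \<integral>x. \<bar>avg (real (Suc n)) g x - avg (real (Suc n)) f x\<bar> \<partial>mX) \<longlonglongrightarrow> 0"
proof -
  have [measurable]: "avg (real (Suc n)) f \<in> borel_measurable borel" "avg (real (Suc n)) g \<in> borel_measurable borel" for n
    using f(1) equiaverageD(1)[OF g] by (simp_all add: measurable_avg)
  have "(\<lambda>n. \<integral>x. \<bar>avg (real (Suc n)) g x - avg (real (Suc n)) f x\<bar> \<partial>mX) \<longlonglongrightarrow> (\<integral>x. 0 \<partial>mX)"
  proof (rule integral_dominated_convergence[where w = "\<lambda>_. 2 * M"])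
    show "AE x in mX. (\<lambda>n. \<bar>avg (real (Suc n)) g x - avg (real (Suc n)) f x\<bar>) \<longlonglongrightarrow> 0"
      using filterlim_compose[OF equiaverageD(3)[OF g] filterlim_Suc_at_top]
      by (intro AE_I2 tendsto_rabs_zero)
    show "AE x in mX. norm \<bar>avg (real (Suc n)) g x - avg (real (Suc n)) f x\<bar> \<le> 2 * M" for n
    proof (rule AE_I2)
      fix x
      show "norm \<bar>avg (real (Suc n)) g x - avg (real (Suc n)) f x\<bar> \<le> 2 * M"
        using avg_bounded[OF f, of "real (Suc n)" x] avg_bounded[OF equiaverageD(1,2)[OF g], of "real (Suc n)" x]
        by simp
    qed
  qed (auto simp del: of_nat_Suc)
  then show ?thesis by simp
qed

text \<open>One \<open>g\<close> serves all large \<open>n\<close>, so the averages of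
  \<open>f\<close> form a Cauchy sequence in the first norm.\<close>

lemma avg_L1_near:
  assumes f: "f \<in> borel_measurable borel" "\<And>x. \<bar>f x\<bar> \<le> M" and \<epsilon>: "\<epsilon> > 0"
  shows "\<exists>g\<in>equiaverage f M. \<exists>N. \<forall>n\<ge>N. (\<integral>x. \<bar>avg (real (Suc n)) f x - g x\<bar> \<partial>mX) \<le> \<epsilon>"
proof -
  obtain g where g: "g \<in> equiaverage f M" and inv: "\<And>h. (\<integral>x. \<bar>g (a h x) - g x\<bar> \<partial>mX) \<le> \<epsilon> / 2"
    using exists_almost_invariant[OF f, of "\<epsilon> / 2"] \<epsilon> by auto
  have bounded_int: "integrable mX (\<lambda>x. \<bar>k x - l x\<bar>)"
    if "k \<in> borel_measurable borel" "\<And>x. \<bar>k x\<bar> \<le> M" "l \<in> borel_measurable borel" "\<And>x. \<bar>l x\<bar> \<le> M" for k l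
    using integrable_bounded[OF that(1,2)] integrable_bounded[OF that(3,4)] by simp
  have "\<forall>\<^sub>F n in sequentially. (\<integral>x. \<bar>avg (real (Suc n)) g x - avg (real (Suc n)) f x\<bar> \<partial>mX) < \<epsilon> / 2"
    using order_tendstoD(2)[OF equiaverage_L1_tendsto[OF f g], of "\<epsilon> / 2"] \<epsilon> by simp
  then obtain N where N: "\<And>n. n \<ge> N \<Longrightarrow> (\<integral>x. \<bar>avg (real (Suc n)) g x - avg (real (Suc n)) f x\<bar> \<partial>mX) < \<epsilon> / 2"
    unfolding eventually_sequentially by blast
  have "(\<integral>x. \<bar>avg (real (Suc n)) f x - g x\<bar> \<partial>mX) \<le> \<epsilon>" if "n \<ge> N" for n
  proof -
    let ?t = "real (Suc n)"
    note b = measurable_avg[OF f(1), of ?t] avg_bounded[OF f, of ?t]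
      measurable_avg[OF equiaverageD(1)[OF g], of ?t] avg_bounded[OF equiaverageD(1,2)[OF g], of ?t]
      equiaverageD(1,2)[OF g]
    have i1: "integrable mX (\<lambda>x. \<bar>avg ?t f x - g x\<bar>)" and i2: "integrable mX (\<lambda>x. \<bar>avg ?t g x - avg ?t f x\<bar>)"
      and i3: "integrable mX (\<lambda>x. \<bar>avg ?t g x - g x\<bar>)"
      using b by (auto intro!: bounded_int)
    have "(\<integral>x. \<bar>avg ?t f x - g x\<bar> \<partial>mX) \<le> (\<integral>x. \<bar>avg ?t g x - avg ?t f x\<bar> + \<bar>avg ?t g x - g x\<bar> \<partial>mX)"
      using i1 i2 i3 by (intro integral_mono Bochner_Integration.integrable_add) auto
    also have "\<dots> = (\<integral>x. \<bar>avg ?t g x - avg ?t f x\<bar> \<partial>mX) + (\<integral>x. \<bar>avg ?t g x - g x\<bar> \<partial>mX)"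
      using i2 i3 by simp
    also have "\<dots> \<le> \<epsilon> / 2 + \<epsilon> / 2"
      using N[OF that] avg_near_almost_invariant[OF equiaverageD(1,2)[OF g] inv, of ?t] by (intro add_mono) auto
    finally show ?thesis by simp
  qed
  with g show ?thesis by blast
qed

text \<open>The averages are \<open>L\<^sup>1\<close>-Cauchy, so a subsequence converges almost everywhere. Its limit is
  invariant at every point, as the definition of ergodicity requires, since \<open>lim\<close> depends only on
  the set of limits, also where there is none.\<close>

lemma exists_equiaverage_near_mean:
  assumes erg: "ergodic_action a mX" and f: "f \<in> borel_measurable borel" "\<And>x. \<bar>f x\<bar> \<le> M" and \<epsilon>: "\<epsilon> > 0"
  shows "\<exists>g\<in>equiaverage f M. (\<integral>x. \<bar>g x - (\<integral>y. f y \<partial>mX)\<bar> \<partial>mX) \<le> \<epsilon>"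
proof -
  let ?c = "\<integral>y. f y \<partial>mX"
  have "\<forall>k::nat. \<exists>g N. g \<in> equiaverage f M \<and> (\<forall>n\<ge>N. (\<integral>x. \<bar>avg (real (Suc n)) f x - g x\<bar> \<partial>mX) \<le> (1/2)^k)"
    using avg_L1_near[OF f, of "(1/2)^k" for k] by (simp add: Bex_def)
  then obtain G where "\<forall>k::nat. \<exists>N. G k \<in> equiaverage f M \<and> (\<forall>n\<ge>N. (\<integral>x. \<bar>avg (real (Suc n)) f x - G k x\<bar> \<partial>mX) \<le> (1/2)^k)"
    by (rule choice[THEN exE])
  then obtain N where GN: "\<forall>k::nat. G k \<in> equiaverage f M \<and> (\<forall>n\<ge>N k. (\<integral>x. \<bar>avg (real (Suc n)) f x - G k x\<bar> \<partial>mX) \<le> (1/2)^k)"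
    by (rule choice[THEN exE])
  \<comment> \<open>The sum over all indices up to \<open>k\<close> makes \<open>m k\<close> and
    \<open>m (Suc k)\<close> both at least \<open>N k\<close>, so that \<open>U k\<close> and
    \<open>U (Suc k)\<close> are close to the same \<open>G k\<close>; the summand \<open>k\<close>
    sends the radii to infinity.\<close>
  define m where "m k = (\<Sum>i\<le>k. N i) + k" for k
  have m1: "N k \<le> m k" for k
    unfolding m_def using member_le_sum[of k "{..k}" N] by simp
  have m2: "N k \<le> m (Suc k)" for k
    unfolding m_def using member_le_sum[of k "{..Suc k}" N] by simp
  have m3: "k \<le> m k" for k by (simp add: m_def)
  define U where "U k x = avg (real (Suc (m k))) f x" for k x
  have Um [measurable]: "U k \<in> borel_measurable borel" for k
    unfolding U_def using f(1) by (rule measurable_avg) simp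
  have Ub: "\<bar>U k x\<bar> \<le> M" for k x
    unfolding U_def using f by (rule avg_bounded) simp
  have UG: "(\<integral>x. \<bar>U k x - G k x\<bar> \<partial>mX) \<le> (1/2)^k" "(\<integral>x. \<bar>U (Suc k) x - G k x\<bar> \<partial>mX) \<le> (1/2)^k" for k
    using GN m1[of k] m2[of k] by (auto simp: U_def)
  have intU: "integrable mX (U k)" and intG: "integrable mX (G k)" for k
    using integrable_bounded[OF Um Ub] integrable_bounded[OF equiaverageD(1,2)[of "G k" f M]] GN by auto
  have step: "(\<integral>x. \<bar>U (Suc k) x - U k x\<bar> \<partial>mX) \<le> 2 * (1/2)^k" for k
  proof -
    have "(\<integral>x. \<bar>U (Suc k) x - U k x\<bar> \<partial>mX) \<le> (\<integral>x. \<bar>U (Suc k) x - G k x\<bar> + \<bar>U k x - G k x\<bar> \<partial>mX)"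
      using intU intG by (intro integral_mono Bochner_Integration.integrable_add integrable_abs Bochner_Integration.integrable_diff) auto
    also have "\<dots> = (\<integral>x. \<bar>U (Suc k) x - G k x\<bar> \<partial>mX) + (\<integral>x. \<bar>U k x - G k x\<bar> \<partial>mX)"
      using intU intG by simp
    finally show ?thesis using UG[of k] by simp
  qed
  have "(\<integral>\<^sup>+x. (\<Sum>k. ennreal \<bar>U (Suc k) x - U k x\<bar>) \<partial>mX) = (\<Sum>k. \<integral>\<^sup>+x. ennreal \<bar>U (Suc k) x - U k x\<bar> \<partial>mX)"
    by (rule nn_integral_suminf) measurable
  also have "\<dots> \<le> (\<Sum>k. ennreal (2 * (1/2)^k))"
    using step intU by (intro suminf_le) (auto simp: nn_integral_eq_integral ennreal_leI)
  also have "\<dots> < \<infinity>"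
    by (subst suminf_ennreal2) (auto intro!: summable_mult summable_geometric)
  finally have "AE x in mX. (\<Sum>k. ennreal \<bar>U (Suc k) x - U k x\<bar>) \<noteq> \<infinity>"
    by (intro nn_integral_PInf_AE) auto
  then have conv: "AE x in mX. convergent (\<lambda>k. U k x)"
  proof eventually_elim
    case (elim x)
    then have "summable (\<lambda>k. \<bar>U (Suc k) x - U k x\<bar>)"
      by (intro summable_suminf_not_top) auto
    then have "summable (\<lambda>k. U (Suc k) x - U k x)"
      by (rule summable_rabs_cancel)
    then have "(\<lambda>n. \<Sum>k<n. U (Suc k) x - U k x) \<longlonglongrightarrow> (\<Sum>k. U (Suc k) x - U k x)"
      by (rule summable_LIMSEQ)
    then have "(\<lambda>n. (U n x - U 0 x) + U 0 x) \<longlonglongrightarrow> (\<Sum>k. U (Suc k) x - U k x) + U 0 x"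
      unfolding sum_lessThan_telescope[of "\<lambda>k. U k x"] by (intro tendsto_add tendsto_const)
    then show ?case by (auto simp: convergent_def)
  qed
  define F where "F x = lim (\<lambda>k. U k x)" for x
  have [measurable]: "F \<in> borel_measurable borel"
    unfolding F_def by measurable
  have tendsto_F: "AE x in mX. (\<lambda>k. U k x) \<longlonglongrightarrow> F x"
    using conv by eventually_elim (simp add: F_def convergent_LIMSEQ_iff)
  have m_top: "filterlim (\<lambda>k. real (Suc (m k))) at_top sequentially"
  proof (rule filterlim_at_top_mono[OF filterlim_real_sequentially], intro always_eventually allI)
    fix k show "real k \<le> real (Suc (m k))" using m3[of k] by simp
  qed
  have inv: "F (a h x) = F x" for h x
  proof -
    have d0: "(\<lambda>k. U k (a h x) - U k x) \<longlonglongrightarrow> 0"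
      unfolding U_def by (rule filterlim_compose[OF avg_at_action_tendsto[OF f] m_top])
    have "(\<lambda>k. U k (a h x)) \<longlonglongrightarrow> L \<longleftrightarrow> (\<lambda>k. U k x) \<longlonglongrightarrow> L" for L
    proof
      assume "(\<lambda>k. U k (a h x)) \<longlonglongrightarrow> L"
      from tendsto_diff[OF this d0] show "(\<lambda>k. U k x) \<longlonglongrightarrow> L" by simp
    next
      assume "(\<lambda>k. U k x) \<longlonglongrightarrow> L"
      from tendsto_add[OF this d0] show "(\<lambda>k. U k (a h x)) \<longlonglongrightarrow> L" by simp
    qed
    then show ?thesis by (simp add: F_def lim_def)
  qed
  have "AE x in mX. norm (F x) \<le> M"
    using tendsto_F
  proof eventually_elim
    case (elim x)
    show ?case
      by (rule LIMSEQ_le_const2[OF tendsto_norm[OF elim]]) (use Ub in auto)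
  qed
  then have intF: "integrable mX F"
    by (intro mX.integrable_const_bound[where B = M]) (auto simp: measurable_mX)
  \<comment> \<open>Identifies the constant: every average has the integral of \<open>f\<close>, and
    bounded convergence passes this on to \<open>F\<close>.\<close>
  have "(\<lambda>k. \<integral>x. U k x \<partial>mX) \<longlonglongrightarrow> (\<integral>x. F x \<partial>mX)"
    using tendsto_F Ub by (intro integral_dominated_convergence[where w = "\<lambda>_. M"]) (auto simp: measurable_mX)
  moreover have "(\<integral>x. U k x \<partial>mX) = ?c" for k
    unfolding U_def using f by (rule integral_avg) simp
  ultimately have "(\<integral>x. F x \<partial>mX) = ?c"
    by (simp add: LIMSEQ_const_iff)
  with ergodic_invariant_AE_const[OF erg intF inv] tendsto_F
  have U_c: "AE x in mX. (\<lambda>k. U k x) \<longlonglongrightarrow> ?c"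
    by (auto elim: eventually_elim2)
  have "(\<lambda>k. \<integral>x. \<bar>U k x - ?c\<bar> \<partial>mX) \<longlonglongrightarrow> (\<integral>x. 0 \<partial>mX)"
  proof (rule integral_dominated_convergence[where w = "\<lambda>_. M + \<bar>?c\<bar>"])
    show "AE x in mX. (\<lambda>k. \<bar>U k x - ?c\<bar>) \<longlonglongrightarrow> 0"
      using U_c by eventually_elim (simp add: tendsto_rabs_zero LIM_zero)
    show "AE x in mX. norm \<bar>U k x - ?c\<bar> \<le> M + \<bar>?c\<bar>" for k
    proof (rule AE_I2)
      fix x show "norm \<bar>U k x - ?c\<bar> \<le> M + \<bar>?c\<bar>" using Ub[of k x] by simp
    qed
  qed auto
  \<comment> \<open>The witness will be a \<open>G k\<close>: it is within \<open>(1/2)^k\<close> of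
    \<open>U k\<close>, which in turn approaches the mean.\<close>
  then have "(\<lambda>k. (1/2)^k + (\<integral>x. \<bar>U k x - ?c\<bar> \<partial>mX)) \<longlonglongrightarrow> 0 + 0"
    by (intro tendsto_add LIMSEQ_power_zero) auto
  then have "\<forall>\<^sub>F k in sequentially. (1/2)^k + (\<integral>x. \<bar>U k x - ?c\<bar> \<partial>mX) < \<epsilon>"
    using \<epsilon> by (intro order_tendstoD(2)[where y = 0]) auto
  then obtain k where k: "(1/2)^k + (\<integral>x. \<bar>U k x - ?c\<bar> \<partial>mX) < \<epsilon>"
    unfolding eventually_sequentially by blast
  have "(\<integral>x. \<bar>G k x - ?c\<bar> \<partial>mX) \<le> (\<integral>x. \<bar>U k x - G k x\<bar> + \<bar>U k x - ?c\<bar> \<partial>mX)"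
    using intU intG by (intro integral_mono Bochner_Integration.integrable_add integrable_abs Bochner_Integration.integrable_diff) auto
  also have "\<dots> = (\<integral>x. \<bar>U k x - G k x\<bar> \<partial>mX) + (\<integral>x. \<bar>U k x - ?c\<bar> \<partial>mX)"
    using intU intG by (intro Bochner_Integration.integral_add integrable_abs Bochner_Integration.integrable_diff) auto
  also have "\<dots> \<le> \<epsilon>"
    using UG(1)[of k] k by simp
  finally show ?thesis using GN by blast
qed

text \<open>Split \<open>f - c\<close> into \<open>f - g\<close> and \<open>g - c\<close>, where
  \<open>c\<close> is the mean and \<open>g\<close> has asymptotically the same averages as
  \<open>f\<close>. The averages of the first part vanish in the limit at every point, and the
  second part is small in the first norm, as Banach's principle asks.\<close>

lemma AE_avg_tendsto_bounded:
  assumes erg: "ergodic_action a mX" and f: "f \<in> borel_measurable borel" "\<And>x. \<bar>f x\<bar> \<le> M"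
  shows "AE x in mX. ((\<lambda>t. avg t f x) \<longlongrightarrow> (\<integral>y. f y \<partial>mX)) at_top"
proof -
  let ?c = "\<integral>y. f y \<partial>mX"
  have intf: "integrable mX f" using f by (rule integrable_bounded)
  have "AE x in mX. ((\<lambda>t. avg t (\<lambda>x. f x - ?c) x) \<longlongrightarrow> 0) at_top"
  proof (rule AE_avg_tendsto_0)
    fix \<epsilon> :: real assume "\<epsilon> > 0"
    then obtain g where g: "g \<in> equiaverage f M" "(\<integral>x. \<bar>g x - ?c\<bar> \<partial>mX) \<le> \<epsilon>"
      using exists_equiaverage_near_mean[OF erg f] by blast
    note gD = equiaverageD[OF g(1)]
    have intg: "integrable mX g" using gD(1,2) by (rule integrable_bounded)
    have "((\<lambda>t. avg t (\<lambda>x. f x - g x) x) \<longlongrightarrow> 0) at_top" for x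
    proof (rule Lim_transform_eventually)
      show "((\<lambda>t. - (avg t g x - avg t f x)) \<longlongrightarrow> 0) at_top"
        using tendsto_minus[OF gD(3)[of x]] by simp
      show "\<forall>\<^sub>F t in at_top. - (avg t g x - avg t f x) = avg t (\<lambda>x. f x - g x) x"
        using eventually_gt_at_top[of 0]
      proof eventually_elim
        case (elim t)
        then show ?case
          using avg_diff[OF orbit_integrable_bounded[OF f] orbit_integrable_bounded[OF gD(1,2)]] by simp
      qed
    qed
    then show "\<exists>v w. integrable mX v \<and> integrable mX w \<and> (\<lambda>x. f x - ?c) = (\<lambda>x. v x + w x) \<and>
        (AE x in mX. ((\<lambda>t. avg t v x) \<longlongrightarrow> 0) at_top) \<and> (\<integral>x. \<bar>w x\<bar> \<partial>mX) \<le> \<epsilon>"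
      using intf intg g(2)
      by (intro exI[of _ "\<lambda>x. f x - g x"] exI[of _ "\<lambda>x. g x - ?c"] conjI) auto
  qed
  then show ?thesis
  proof eventually_elim
    case (elim x)
    show ?case
    proof (rule LIM_zero_cancel, rule Lim_transform_eventually[OF elim])
      show "\<forall>\<^sub>F t in at_top. avg t (\<lambda>x. f x - ?c) x = avg t f x - ?c"
        using eventually_gt_at_top[of 0]
      proof eventually_elim
        case (elim t)
        have "avg t (\<lambda>x. f x - ?c) x = avg t f x - avg t (\<lambda>_. ?c) x"
          using elim f by (intro avg_diff orbit_integrable_bounded[where M = "max M \<bar>?c\<bar>"]) (auto simp: le_max_iff_disj)
        then show ?case using elim by (simp add: avg_const)
      qed
    qed
  qed
qed

end

section \<open>Convergence in \<open>L\<^sup>p\<close>\<close>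

text \<open>The tangent of \<open>y powr p\<close> at \<open>s\<close>, with terms arranged so that
  no subtraction remains when it is read in \<open>ennreal\<close>. It is Young's inequality for the
  exponent \<open>p\<close> and its conjugate.\<close>

lemma powr_tangent_le:
  fixes p s y :: real
  assumes "p \<ge> 1" "s \<ge> 0" "y \<ge> 0"
  shows "p * s powr (p - 1) * y \<le> y powr p + (p - 1) * s powr p"
\<comment> \<open>At \<open>p = 1\<close> there is no finite conjugate exponent, and
  \<open>0 powr 0\<close> is 0 by convention.\<close>
proof (cases "p = 1 \<or> s = 0")
  case True
  then show ?thesis using assms by (auto simp: powr_def)
next
  case False
  then have p: "p > 1" and s: "s > 0" using assms by auto
  define q where "q = p / (p - 1)"
  have q: "q > 1" "1 / p + 1 / q = 1" "(p - 1) * q = p" "p / q = p - 1"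
    using p by (auto simp: q_def field_simps)
  have "y * s powr (p - 1) \<le> y powr p / p + (s powr (p - 1)) powr q / q"
    using p q(1,2) assms by (intro Youngs_inequality) auto
  also have "(s powr (p - 1)) powr q = s powr p"
    by (simp add: powr_powr q(3))
  finally have "p * (y * s powr (p - 1)) \<le> p * (y powr p / p + s powr p / q)"
    using p by (intro mult_left_mono) auto
  also have "\<dots> = y powr p + (p / q) * s powr p"
    using p by (simp add: field_simps)
  finally show ?thesis by (simp add: q(4) mult_ac)
qed

text \<open>The sum is at most three times the largest of the absolute values, whence the
  constant.\<close>

lemma abs_add3_powr_le:
  fixes x y z p :: real
  assumes "p \<ge> 0"
  shows "\<bar>x + y + z\<bar> powr p \<le> 3 powr p * (\<bar>x\<bar> powr p + \<bar>y\<bar> powr p + \<bar>z\<bar> powr p)"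
proof -
  define u where "u = max \<bar>x\<bar> (max \<bar>y\<bar> \<bar>z\<bar>)"
  have "\<bar>x + y + z\<bar> powr p \<le> (3 * u) powr p"
    using assms by (intro powr_mono2) (auto simp: u_def)
  also have "\<dots> = 3 powr p * u powr p"
    by (rule powr_mult)
  also have "u powr p \<le> \<bar>x\<bar> powr p + \<bar>y\<bar> powr p + \<bar>z\<bar> powr p"
    unfolding u_def by (auto simp: max_def)
  finally show ?thesis by simp
qed

context doubling_group_action
begin

text \<open>Cutting large values to 0, not to the bound, makes the error equal to 0 or to
  \<open>f\<close> itself, so the power of \<open>f\<close> dominates. Used with the exponents 1 and
  \<open>p\<close>.\<close>

lemma truncation_tendsto:
  fixes f :: "'x \<Rightarrow> real"
  assumes [measurable]: "f \<in> borel_measurable borel" and int: "integrable mX (\<lambda>x. \<bar>f x\<bar> powr p)" and p: "p \<ge> 1"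
  shows "(\<lambda>j::nat. \<integral>x. \<bar>f x - (if \<bar>f x\<bar> \<le> real j then f x else 0)\<bar> powr p \<partial>mX) \<longlonglongrightarrow> 0"
proof -
  have "(\<lambda>j::nat. \<integral>x. \<bar>f x - (if \<bar>f x\<bar> \<le> real j then f x else 0)\<bar> powr p \<partial>mX) \<longlonglongrightarrow> (\<integral>x. 0 \<partial>mX)"
  proof (rule integral_dominated_convergence[OF _ _ int])
    show "AE x in mX. (\<lambda>j::nat. \<bar>f x - (if \<bar>f x\<bar> \<le> real j then f x else 0)\<bar> powr p) \<longlonglongrightarrow> 0"
    proof (rule AE_I2, rule tendsto_eventually)
      fix x
      have "\<forall>\<^sub>F j in sequentially. \<bar>f x\<bar> \<le> real j"
        using filterlim_real_sequentially by (simp add: filterlim_at_top)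
      then show "\<forall>\<^sub>F j in sequentially. \<bar>f x - (if \<bar>f x\<bar> \<le> real j then f x else 0)\<bar> powr p = 0"
        by eventually_elim simp
    qed
  qed auto
  then show ?thesis by simp
qed

lemma AE_avg_tendsto:
  assumes erg: "ergodic_action a mX" and f: "integrable mX f"
  shows "AE x in mX. ((\<lambda>t. avg t f x) \<longlongrightarrow> (\<integral>y. f y \<partial>mX)) at_top"
proof -
  let ?c = "\<integral>y. f y \<partial>mX"
  have [measurable]: "f \<in> borel_measurable borel"
    using borel_measurable_integrable[OF f] by (simp add: measurable_mX)
  have "AE x in mX. ((\<lambda>t. avg t (\<lambda>x. f x - ?c) x) \<longlongrightarrow> 0) at_top"
  proof (rule AE_avg_tendsto_0)
    fix \<epsilon> :: real assume "\<epsilon> > 0"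
    define F where "F j x = (if \<bar>f x\<bar> \<le> real j then f x else 0)" for j :: nat and x
    have [measurable]: "F j \<in> borel_measurable borel" for j unfolding F_def by measurable
    have Fb: "\<bar>F j x\<bar> \<le> real j" for j x by (simp add: F_def)
    have intF: "integrable mX (F j)" for j by (rule integrable_bounded[OF _ Fb]) measurable
    have "(\<lambda>j. \<integral>x. \<bar>f x - F j x\<bar> \<partial>mX) \<longlonglongrightarrow> 0"
      using truncation_tendsto[of f 1] f by (simp add: F_def)
    then have "\<forall>\<^sub>F j in sequentially. (\<integral>x. \<bar>f x - F j x\<bar> \<partial>mX) < \<epsilon> / 2"
      using \<open>\<epsilon> > 0\<close> by (intro order_tendstoD(2)[where y = 0]) auto
    then obtain j where j: "(\<integral>x. \<bar>f x - F j x\<bar> \<partial>mX) < \<epsilon> / 2"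
      unfolding eventually_sequentially by blast
    let ?c' = "\<integral>y. F j y \<partial>mX"
    \<comment> \<open>Both parts are to have mean 0 where needed, so the difference of the two means
      is put into the error. It is bounded by the truncation error, hence the halves of
      \<epsilon>.\<close>
    let ?v = "\<lambda>x. F j x - ?c'" and ?w = "\<lambda>x. (f x - F j x) - (?c - ?c')"
    have "AE x in mX. ((\<lambda>t. avg t (F j) x) \<longlongrightarrow> ?c') at_top"
      using erg _ Fb by (rule AE_avg_tendsto_bounded) measurable
    then have "AE x in mX. ((\<lambda>t. avg t ?v x) \<longlongrightarrow> 0) at_top"
    proof eventually_elim
      case (elim x)
      show ?case
      proof (rule Lim_transform_eventually[OF LIM_zero[OF elim]])
        show "\<forall>\<^sub>F t in at_top. avg t (F j) x - ?c' = avg t ?v x"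
          using eventually_gt_at_top[of 0]
        proof eventually_elim
          case (elim t)
          have "avg t ?v x = avg t (F j) x - avg t (\<lambda>_. ?c') x"
            using elim Fb by (intro avg_diff orbit_integrable_bounded[where M = "max (real j) \<bar>?c'\<bar>"])
              (auto simp: le_max_iff_disj)
          then show ?case using elim by (simp add: avg_const)
        qed
      qed
    qed
    moreover have "(\<integral>x. \<bar>?w x\<bar> \<partial>mX) \<le> \<epsilon>"
    proof -
      have "\<bar>?c - ?c'\<bar> = \<bar>\<integral>x. f x - F j x \<partial>mX\<bar>" using f intF by simp
      also have "\<dots> \<le> (\<integral>x. \<bar>f x - F j x\<bar> \<partial>mX)" by (rule integral_abs_bound)
      finally have 1: "\<bar>?c - ?c'\<bar> \<le> (\<integral>x. \<bar>f x - F j x\<bar> \<partial>mX)" .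
      have "(\<integral>x. \<bar>?w x\<bar> \<partial>mX) \<le> (\<integral>x. \<bar>f x - F j x\<bar> + \<bar>?c - ?c'\<bar> \<partial>mX)"
      proof (rule integral_mono)
        show "\<bar>?w x\<bar> \<le> \<bar>f x - F j x\<bar> + \<bar>?c - ?c'\<bar>" for x by (rule abs_triangle_ineq4)
      qed (use f intF in auto)
      also have "\<dots> = (\<integral>x. \<bar>f x - F j x\<bar> \<partial>mX) + \<bar>?c - ?c'\<bar>" using f intF by simp
      finally show ?thesis using 1 j by linarith
    qed
    ultimately show "\<exists>v w. integrable mX v \<and> integrable mX w \<and> (\<lambda>x. f x - ?c) = (\<lambda>x. v x + w x) \<and>
        (AE x in mX. ((\<lambda>t. avg t v x) \<longlongrightarrow> 0) at_top) \<and> (\<integral>x. \<bar>w x\<bar> \<partial>mX) \<le> \<epsilon>"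
      using f intF by (intro exI[of _ ?v] exI[of _ ?w] conjI) auto
  qed
  moreover have "AE x in mX. \<forall>t>0. orbit_integrable t f x"
    using f by (rule AE_orbit_integrable)
  ultimately show ?thesis
  proof eventually_elim
    case (elim x)
    show ?case
    proof (rule LIM_zero_cancel, rule Lim_transform_eventually[OF elim(1)])
      show "\<forall>\<^sub>F t in at_top. avg t (\<lambda>x. f x - ?c) x = avg t f x - ?c"
        using eventually_gt_at_top[of 0]
      proof eventually_elim
        case t: (elim t)
        have "avg t (\<lambda>x. f x - ?c) x = avg t f x - avg t (\<lambda>_. ?c) x"
        proof (rule avg_diff)
          show "orbit_integrable t f x" using t elim(2) by blast
          show "orbit_integrable t (\<lambda>_. ?c) x"
            using t by (intro orbit_integrable_bounded[where M = "\<bar>?c\<bar>"]) auto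
        qed
        then show ?case using t by (simp add: avg_const)
      qed
    qed
  qed
qed

section \<open>Contraction and norm convergence\<close>

text \<open>Jensen's inequality, in the form of the tangent to \<open>y powr p\<close> at \<open>\<bar>avg t w x\<bar>\<close>.\<close>

lemma avg_powr_le_ball_sum:
  assumes [measurable]: "w \<in> borel_measurable borel" and p: "p \<ge> 1" and t: "t > 0"
  shows "ennreal (\<bar>avg t w x\<bar> powr p * measure mG (B t)) \<le> ball_sum (\<lambda>x. ennreal (\<bar>w x\<bar> powr p)) t x"
proof -
  note [measurable] = ball_measurable[OF t]
  define s where "s = \<bar>avg t w x\<bar>"
  define V where "V = measure mG (B t)"
  define X where "X = ball_sum (\<lambda>x. ennreal (\<bar>w x\<bar> powr p)) t x"
  have s: "s \<ge> 0" and V: "V > 0" by (simp_all add: s_def V_def measure_ball_pos[OF t])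
  have "s * s powr (p - 1) = s powr p"
    using s by (cases "s = 0") (auto simp: powr_diff)
  then have "ennreal (p * s powr p * V) = ennreal (p * s powr (p - 1)) * ennreal (s * V)"
    using p s V by (simp flip: ennreal_mult add: mult_ac)
  also have "\<dots> \<le> ennreal (p * s powr (p - 1)) * ball_sum (\<lambda>x. ennreal \<bar>w x\<bar>) t x"
    using avg_abs_le_ball_sum[OF t, of w x] by (intro mult_left_mono) (auto simp: s_def V_def)
  also have "\<dots> = (\<integral>\<^sup>+u. ennreal (p * s powr (p - 1)) * (ennreal \<bar>w (a (ginv u) x)\<bar> * indicator (B t) u) \<partial>mG)"
    unfolding ball_sum_def by (rule nn_integral_cmult[symmetric]) measurable
  also have "\<dots> \<le> (\<integral>\<^sup>+u. ennreal (\<bar>w (a (ginv u) x)\<bar> powr p) * indicator (B t) u + ennreal ((p - 1) * s powr p) * indicator (B t) u \<partial>mG)"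
  proof (rule nn_integral_mono)
    fix u
    have "ennreal (p * s powr (p - 1)) * ennreal \<bar>w (a (ginv u) x)\<bar>
        \<le> ennreal (\<bar>w (a (ginv u) x)\<bar> powr p) + ennreal ((p - 1) * s powr p)"
      using powr_tangent_le[OF p s, of "\<bar>w (a (ginv u) x)\<bar>"] p
      by (simp flip: ennreal_mult ennreal_plus add: ennreal_leI)
    then show "ennreal (p * s powr (p - 1)) * (ennreal \<bar>w (a (ginv u) x)\<bar> * indicator (B t) u)
        \<le> ennreal (\<bar>w (a (ginv u) x)\<bar> powr p) * indicator (B t) u + ennreal ((p - 1) * s powr p) * indicator (B t) u"
      by (simp add: indicator_def)
  qed
  also have "\<dots> = X + (\<integral>\<^sup>+u. ennreal ((p - 1) * s powr p) * indicator (B t) u \<partial>mG)"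
    unfolding X_def ball_sum_def by (rule nn_integral_add) measurable
  also have "(\<integral>\<^sup>+u. ennreal ((p - 1) * s powr p) * indicator (B t) u \<partial>mG) = ennreal ((p - 1) * s powr p * V)"
    using p t by (simp add: nn_integral_cmult_indicator emeasure_ball V_def ennreal_mult)
  finally have *: "ennreal (p * s powr p * V) \<le> X + ennreal ((p - 1) * s powr p * V)" .
  show ?thesis
  \<comment> \<open>If \<open>X\<close> is infinite the claim is trivial. Otherwise all terms are
    real and the multiple of \<open>p - 1\<close> can be cancelled.\<close>
  proof (cases X)
    case (real r)
    with * have "ennreal (p * s powr p * V) \<le> ennreal (r + (p - 1) * s powr p * V)"
      using p V by (simp add: ennreal_plus)
    then have "p * s powr p * V \<le> r + (p - 1) * s powr p * V"
      using p V real by (subst (asm) ennreal_le_iff) auto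
    then have "s powr p * V \<le> r" by (simp add: algebra_simps)
    then show ?thesis
      using real by (simp add: X_def s_def V_def ennreal_leI)
  qed (simp add: X_def)
qed

text \<open>Integrates the pointwise Jensen inequality; invariance of the measure evaluates the ball
  sum, and the measure of the ball, positive and finite, cancels.\<close>

lemma nn_integral_avg_powr_le:
  assumes w [measurable]: "w \<in> borel_measurable borel" and p: "p \<ge> 1" and t: "t > 0"
  shows "(\<integral>\<^sup>+x. ennreal (\<bar>avg t w x\<bar> powr p) \<partial>mX) \<le> (\<integral>\<^sup>+x. ennreal (\<bar>w x\<bar> powr p) \<partial>mX)"
proof -
  have [measurable]: "avg t w \<in> borel_measurable borel" using w t by (rule measurable_avg)
  have V: "emeasure mG (B t) \<noteq> 0" "emeasure mG (B t) \<noteq> \<infinity>"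
    using pos_balls[OF t] emeasure_ball_finite[OF t] by auto
  have "(\<integral>\<^sup>+x. ennreal (\<bar>avg t w x\<bar> powr p) \<partial>mX) * emeasure mG (B t)
      = (\<integral>\<^sup>+x. ennreal (\<bar>avg t w x\<bar> powr p * measure mG (B t)) \<partial>mX)"
    using t by (simp add: nn_integral_multc emeasure_ball ennreal_mult)
  also have "\<dots> \<le> (\<integral>\<^sup>+x. ball_sum (\<lambda>x. ennreal (\<bar>w x\<bar> powr p)) t x \<partial>mX)"
    using p t by (intro nn_integral_mono avg_powr_le_ball_sum) auto
  also have "\<dots> = (\<integral>\<^sup>+x. ennreal (\<bar>w x\<bar> powr p) \<partial>mX) * emeasure mG (B t)"
    using t by (simp add: nn_integral_ball_sum mult.commute)
  finally have "(\<integral>\<^sup>+x. ennreal (\<bar>avg t w x\<bar> powr p) \<partial>mX) * emeasure mG (B t) / emeasure mG (B t)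
      \<le> (\<integral>\<^sup>+x. ennreal (\<bar>w x\<bar> powr p) \<partial>mX) * emeasure mG (B t) / emeasure mG (B t)"
    by (rule divide_right_mono_ennreal)
  then show ?thesis using V by (simp add: ennreal_mult_divide_eq)
qed

lemma Lp_avg_tendsto_bounded:
  assumes erg: "ergodic_action a mX" and f: "f \<in> borel_measurable borel" "\<And>x. \<bar>f x\<bar> \<le> M" and p: "p \<ge> 1"
  shows "((\<lambda>t. \<integral>\<^sup>+x. ennreal (\<bar>avg t f x - (\<integral>y. f y \<partial>mX)\<bar> powr p) \<partial>mX) \<longlongrightarrow> 0) at_top"
proof -
  let ?c = "\<integral>y. f y \<partial>mX"
  \<comment> \<open>Dominated convergence wants measurability for every real \<open>t\<close>. The
    radius \<open>max 1 t\<close> is always positive and eventually equals \<open>t\<close>.\<close>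
  have [measurable]: "avg (max 1 t) f \<in> borel_measurable borel" for t
    using f(1) by (rule measurable_avg) simp
  have bd: "\<bar>avg (max 1 t) f x - ?c\<bar> powr p \<le> (M + \<bar>?c\<bar>) powr p" for t x
  proof (rule powr_mono2)
    have "\<bar>avg (max 1 t) f x\<bar> \<le> M" using f by (rule avg_bounded) simp
    then show "\<bar>avg (max 1 t) f x - ?c\<bar> \<le> M + \<bar>?c\<bar>" by linarith
  qed (use p in auto)
  have "((\<lambda>t. \<integral>x. \<bar>avg (max 1 t) f x - ?c\<bar> powr p \<partial>mX) \<longlongrightarrow> (\<integral>x. 0 \<partial>mX)) at_top"
  proof (rule integral_dominated_convergence_at_top[where w = "\<lambda>_. (M + \<bar>?c\<bar>) powr p"])
    show "AE x in mX. ((\<lambda>t. \<bar>avg (max 1 t) f x - ?c\<bar> powr p) \<longlongrightarrow> 0) at_top"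
      using AE_avg_tendsto_bounded[OF erg f]
    proof eventually_elim
      case (elim x)
      have "((\<lambda>t. \<bar>avg t f x - ?c\<bar> powr p) \<longlongrightarrow> 0 powr p) at_top"
        using p by (intro tendsto_powr' tendsto_const tendsto_rabs_zero LIM_zero[OF elim]) auto
      then have "((\<lambda>t. \<bar>avg t f x - ?c\<bar> powr p) \<longlongrightarrow> 0) at_top" by simp
      moreover have "\<forall>\<^sub>F t in at_top. \<bar>avg t f x - ?c\<bar> powr p = \<bar>avg (max 1 t) f x - ?c\<bar> powr p"
        using eventually_ge_at_top[of 1] by eventually_elim (simp add: max_def)
      ultimately show ?case by (rule Lim_transform_eventually)
    qed
    show "\<forall>\<^sub>F t in at_top. AE x in mX. norm (\<bar>avg (max 1 t) f x - ?c\<bar> powr p) \<le> (M + \<bar>?c\<bar>) powr p"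
      using bd by (intro always_eventually allI AE_I2) simp
  qed auto
  then have "((\<lambda>t. ennreal (\<integral>x. \<bar>avg (max 1 t) f x - ?c\<bar> powr p \<partial>mX)) \<longlongrightarrow> ennreal 0) at_top"
    by (intro tendsto_ennrealI) simp
  moreover have "\<forall>\<^sub>F t in at_top. ennreal (\<integral>x. \<bar>avg (max 1 t) f x - ?c\<bar> powr p \<partial>mX)
      = (\<integral>\<^sup>+x. ennreal (\<bar>avg t f x - ?c\<bar> powr p) \<partial>mX)"
    using eventually_ge_at_top[of 1]
  proof eventually_elim
    case (elim t)
    have "integrable mX (\<lambda>x. \<bar>avg (max 1 t) f x - ?c\<bar> powr p)"
      using bd[of t] by (intro integrable_bounded[where M = "(M + \<bar>?c\<bar>) powr p"]) auto
    then show ?case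
      using elim by (subst nn_integral_eq_integral[symmetric]) (auto simp: max_def)
  qed
  ultimately have "((\<lambda>t. \<integral>\<^sup>+x. ennreal (\<bar>avg t f x - ?c\<bar> powr p) \<partial>mX) \<longlongrightarrow> ennreal 0) at_top"
    by (rule Lim_transform_eventually)
  then show ?thesis by simp
qed

text \<open>The error splits into the error of a bounded truncation, the average of the remainder
  and the difference of the means. The contraction bounds the second uniformly in \<open>t\<close>,
  so \<open>j\<close> can be fixed before \<open>t\<close> grows.\<close>

lemma Lp_avg_tendsto:
  assumes erg: "ergodic_action a mX" and f [measurable]: "f \<in> borel_measurable borel"
    and fp: "integrable mX (\<lambda>x. \<bar>f x\<bar> powr p)" and intf: "integrable mX f" and p: "p \<ge> 1"
  shows "((\<lambda>t. \<integral>\<^sup>+x. ennreal (\<bar>avg t f x - (\<integral>y. f y \<partial>mX)\<bar> powr p) \<partial>mX) \<longlongrightarrow> 0) at_top"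
proof -
  let ?c = "\<integral>y. f y \<partial>mX"
  define F where "F j x = (if \<bar>f x\<bar> \<le> real j then f x else 0)" for j :: nat and x
  define c where "c j = (\<integral>y. F j y \<partial>mX)" for j
  have Fm [measurable]: "F j \<in> borel_measurable borel" for j unfolding F_def by measurable
  have Fb: "\<bar>F j x\<bar> \<le> real j" for j x by (simp add: F_def)
  have intF: "integrable mX (F j)" for j by (rule integrable_bounded[OF Fm Fb])
  have a: "(\<lambda>j. \<integral>x. \<bar>f x - F j x\<bar> powr p \<partial>mX) \<longlonglongrightarrow> 0"
    unfolding F_def using f fp p by (rule truncation_tendsto)
  have lim1: "(\<lambda>j. \<integral>x. \<bar>f x - F j x\<bar> \<partial>mX) \<longlonglongrightarrow> 0"
    using truncation_tendsto[of f 1] intf by (simp add: F_def)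
  have c_le: "norm (c j - ?c) \<le> (\<integral>x. \<bar>f x - F j x\<bar> \<partial>mX)" for j
  proof -
    have "norm (c j - ?c) = \<bar>\<integral>x. f x - F j x \<partial>mX\<bar>" using intf intF by (simp add: c_def)
    also have "\<dots> \<le> (\<integral>x. \<bar>f x - F j x\<bar> \<partial>mX)" by (rule integral_abs_bound)
    finally show ?thesis .
  qed
  have "(\<lambda>j. c j - ?c) \<longlonglongrightarrow> 0"
    by (rule Lim_null_comparison[OF _ lim1]) (intro always_eventually allI c_le)
  then have b: "(\<lambda>j. \<bar>c j - ?c\<bar> powr p) \<longlonglongrightarrow> 0 powr p"
    using p by (intro tendsto_powr' tendsto_const tendsto_rabs_zero) auto
  have small: "\<forall>\<^sub>F t in at_top. (\<integral>\<^sup>+x. ennreal (\<bar>avg t f x - ?c\<bar> powr p) \<partial>mX) < ennreal \<delta>" if "\<delta> > 0" for \<delta>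
  proof -
    have "(\<lambda>j. 3 powr p * ((\<integral>x. \<bar>f x - F j x\<bar> powr p \<partial>mX) + \<bar>c j - ?c\<bar> powr p)) \<longlonglongrightarrow> 3 powr p * (0 + 0 powr p)"
      by (intro tendsto_mult tendsto_const tendsto_add a b)
    then have "\<forall>\<^sub>F j in sequentially. 3 powr p * ((\<integral>x. \<bar>f x - F j x\<bar> powr p \<partial>mX) + \<bar>c j - ?c\<bar> powr p) < \<delta> / 2"
      by (rule order_tendstoD(2)) (use that in simp)
    then obtain j where j: "3 powr p * ((\<integral>x. \<bar>f x - F j x\<bar> powr p \<partial>mX) + \<bar>c j - ?c\<bar> powr p) < \<delta> / 2"
      unfolding eventually_sequentially by blast
    have "((\<lambda>t. \<integral>\<^sup>+x. ennreal (\<bar>avg t (F j) x - c j\<bar> powr p) \<partial>mX) \<longlongrightarrow> 0) at_top"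
      unfolding c_def using erg Fm Fb p by (rule Lp_avg_tendsto_bounded)
    \<comment> \<open>The denominator anticipates the factor \<open>3 powr p\<close> from splitting
      into three terms.\<close>
    then have "\<forall>\<^sub>F t in at_top. (\<integral>\<^sup>+x. ennreal (\<bar>avg t (F j) x - c j\<bar> powr p) \<partial>mX) < ennreal (\<delta> / (2 * 3 powr p))"
      using that by (intro order_tendstoD(2)[where y = 0]) auto
    then show ?thesis
      using eventually_gt_at_top[of 0]
    proof eventually_elim
      case (elim t)
      define w where "w x = f x - F j x" for x
      have w [measurable]: "w \<in> borel_measurable borel" unfolding w_def by measurable
      have [measurable]: "avg t w \<in> borel_measurable borel" "avg t (F j) \<in> borel_measurable borel"
        using w Fm elim(2) by (auto intro!: measurable_avg)
      have intw: "integrable mX (\<lambda>x. \<bar>w x\<bar> powr p)"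
      proof (rule Bochner_Integration.integrable_bound[OF fp])
        show "AE x in mX. norm (\<bar>w x\<bar> powr p) \<le> norm (\<bar>f x\<bar> powr p)"
          using p by (intro AE_I2) (simp add: w_def F_def)
      qed measurable
      \<comment> \<open>Only almost everywhere, because the average is additive where the orbit
        function of \<open>f\<close> is integrable.\<close>
      have "AE x in mX. avg t f x - ?c = (avg t (F j) x - c j) + avg t w x + (c j - ?c)"
        using AE_orbit_integrable[OF intf] 
      proof eventually_elim
        case x: (elim x)
        have "avg t w x = avg t f x - avg t (F j) x"
          unfolding w_def
        proof (rule avg_diff)
          show "orbit_integrable t f x" using x elim(2) by blast
          show "orbit_integrable t (F j) x" using Fm Fb elim(2) by (rule orbit_integrable_bounded)
        qed
        then show ?case by simp
      qed
      then have "(\<integral>\<^sup>+x. ennreal (\<bar>avg t f x - ?c\<bar> powr p) \<partial>mX)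
          \<le> (\<integral>\<^sup>+x. ennreal (3 powr p) * (ennreal (\<bar>avg t (F j) x - c j\<bar> powr p) + ennreal (\<bar>avg t w x\<bar> powr p)
              + ennreal (\<bar>c j - ?c\<bar> powr p)) \<partial>mX)"
      proof (intro nn_integral_mono_AE, eventually_elim)
        case (elim x)
        have "ennreal (\<bar>avg t f x - ?c\<bar> powr p)
            \<le> ennreal (3 powr p * (\<bar>avg t (F j) x - c j\<bar> powr p + \<bar>avg t w x\<bar> powr p + \<bar>c j - ?c\<bar> powr p))"
          unfolding elim using p by (intro ennreal_leI abs_add3_powr_le) simp
        then show ?case by (simp add: ennreal_mult)
      qed
      also have "\<dots> = ennreal (3 powr p) * ((\<integral>\<^sup>+x. ennreal (\<bar>avg t (F j) x - c j\<bar> powr p) \<partial>mX)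
          + (\<integral>\<^sup>+x. ennreal (\<bar>avg t w x\<bar> powr p) \<partial>mX) + ennreal (\<bar>c j - ?c\<bar> powr p))"
        by (simp add: nn_integral_cmult nn_integral_add)
      also have "\<dots> \<le> ennreal (3 powr p) * ((\<integral>\<^sup>+x. ennreal (\<bar>avg t (F j) x - c j\<bar> powr p) \<partial>mX)
          + ennreal (\<integral>x. \<bar>w x\<bar> powr p \<partial>mX) + ennreal (\<bar>c j - ?c\<bar> powr p))"
        using nn_integral_avg_powr_le[OF w p elim(2)] intw
        by (intro mult_left_mono add_mono) (auto simp: nn_integral_eq_integral)
      also have "\<dots> = ennreal (3 powr p) * (\<integral>\<^sup>+x. ennreal (\<bar>avg t (F j) x - c j\<bar> powr p) \<partial>mX)
          + ennreal (3 powr p * ((\<integral>x. \<bar>w x\<bar> powr p \<partial>mX) + \<bar>c j - ?c\<bar> powr p))"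
        by (simp add: ennreal_mult ennreal_plus distrib_left add.assoc)
      also have "\<dots> < ennreal (\<delta> / 2) + ennreal (\<delta> / 2)"
      proof (rule add_strict_mono)
        have "ennreal (3 powr p) * (\<integral>\<^sup>+x. ennreal (\<bar>avg t (F j) x - c j\<bar> powr p) \<partial>mX)
            < ennreal (3 powr p) * ennreal (\<delta> / (2 * 3 powr p))"
          using elim(1) by (intro ennreal_mult_strict_left_mono) auto
        also have "\<dots> = ennreal (\<delta> / 2)"
          using that by (simp flip: ennreal_mult)
        finally show "ennreal (3 powr p) * (\<integral>\<^sup>+x. ennreal (\<bar>avg t (F j) x - c j\<bar> powr p) \<partial>mX) < ennreal (\<delta> / 2)" .
        show "ennreal (3 powr p * ((\<integral>x. \<bar>w x\<bar> powr p \<partial>mX) + \<bar>c j - ?c\<bar> powr p)) < ennreal (\<delta> / 2)"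
          using j that by (intro ennreal_lessI) (auto simp: w_def)
      qed
      also have "\<dots> = ennreal \<delta>" using that by (simp flip: ennreal_plus)
      finally show ?case .
    qed
  qed
  show ?thesis
  proof (rule order_tendstoI)
    fix y :: ennreal assume "0 < y"
    then obtain \<delta> where "\<delta> > 0" "ennreal \<delta> \<le> y"
    proof (cases y)
      case (real r)
      with \<open>0 < y\<close> show ?thesis by (intro that[of r]) auto
    next
      case top
      then show ?thesis by (intro that[of 1]) auto
    qed
    then show "\<forall>\<^sub>F t in at_top. (\<integral>\<^sup>+x. ennreal (\<bar>avg t f x - ?c\<bar> powr p) \<partial>mX) < y"
      using small[of \<delta>] by (auto elim!: eventually_mono intro: less_le_trans)
  qed simp
qed

end

theorem theorem5p1:
  fixes mul :: "'g::{t2_space,second_countable_topology} \<Rightarrow> 'g \<Rightarrow> 'g"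
    and ginv :: "'g \<Rightarrow> 'g" and e :: 'g
    and mG :: "'g measure" and d :: "'g \<Rightarrow> 'g \<Rightarrow> real" and C :: real
  assumes grp: "lcsc_group mul ginv e"
    and haar: "haar_measure mul mG"
    and metric: "left_invariant_metric mul d"
    and compact_balls: "\<And>t. t > 0 \<Longrightarrow> compact (ball_d d e t)"
    and pos_balls: "\<And>t. t > 0 \<Longrightarrow> emeasure mG (ball_d d e t) > 0"
    and doubling: "\<And>t. t > 0 \<Longrightarrow> measure mG (ball_d d e (2 * t)) \<le> C * measure mG (ball_d d e t)"
    and asymp_inv: "\<And>g. ((\<lambda>t. measure mG (symdiff ((\<lambda>h. mul h g) ` ball_d d e t) (ball_d d e t))
                              / measure mG (ball_d d e t)) \<longlongrightarrow> 0) at_top"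
  shows "\<forall>(a :: 'g \<Rightarrow> 'x::polish_space \<Rightarrow> 'x) (mX :: 'x measure) (f :: 'x \<Rightarrow> real) (p :: real).
           prob_space mX \<and> sets mX = sets borel \<and> mp_action mul e mG a mX \<and> ergodic_action a mX \<and>
           1 \<le> p \<and> f \<in> borel_measurable mX \<and> integrable mX (\<lambda>x. \<bar>f x\<bar> powr p)
           \<longrightarrow> (AE x in mX. ((\<lambda>t. ball_average ginv mG (ball_d d e t) a f x)
                                    \<longlongrightarrow> integral\<^sup>L mX f) at_top)
             \<and> ((\<lambda>t. \<integral>\<^sup>+ x. ennreal (\<bar>ball_average ginv mG (ball_d d e t) a f x - integral\<^sup>L mX f\<bar> powr p) \<partial>mX)
                   \<longlongrightarrow> 0) at_top"
proof (intro allI impI)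
  fix a :: "'g \<Rightarrow> 'x::polish_space \<Rightarrow> 'x" and mX :: "'x measure" and f :: "'x \<Rightarrow> real" and p :: real
  assume H: "prob_space mX \<and> sets mX = sets borel \<and> mp_action mul e mG a mX \<and> ergodic_action a mX \<and>
           1 \<le> p \<and> f \<in> borel_measurable mX \<and> integrable mX (\<lambda>x. \<bar>f x\<bar> powr p)"
  interpret doubling_group mul ginv e mG d C
    by (rule doubling_group.intro) (fact assms)+
  interpret mX: prob_space mX using H by blast
  interpret doubling_group_action mul ginv e mG d C mX a
    by unfold_locales (use H in auto)
  have f: "f \<in> borel_measurable borel" using H by (simp add: measurable_mX)
  \<comment> \<open>On a probability space the power is enough: the absolute value of
    \<open>f x\<close> is at most \<open>1 + \<bar>f x\<bar> powr p\<close>.\<close>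
  have "integrable mX f"
  proof (rule Bochner_Integration.integrable_bound)
    show "integrable mX (\<lambda>x. 1 + \<bar>f x\<bar> powr p)" using H by simp
    show "AE x in mX. norm (f x) \<le> norm (1 + \<bar>f x\<bar> powr p)"
    proof (rule AE_I2)
      fix x
      show "norm (f x) \<le> norm (1 + \<bar>f x\<bar> powr p)"
      proof (cases "\<bar>f x\<bar> \<le> 1")
        case False
        then have "\<bar>f x\<bar> powr 1 \<le> \<bar>f x\<bar> powr p" using H by (intro powr_mono) auto
        then show ?thesis by simp
      qed (simp add: add_increasing2)
    qed
  qed (use H in blast)
  then show "(AE x in mX. ((\<lambda>t. ball_average ginv mG (ball_d d e t) a f x) \<longlongrightarrow> integral\<^sup>L mX f) at_top)
      \<and> ((\<lambda>t. \<integral>\<^sup>+ x. ennreal (\<bar>ball_average ginv mG (ball_d d e t) a f x - integral\<^sup>L mX f\<bar> powr p) \<partial>mX) \<longlongrightarrow> 0) at_top"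
    using H f by (intro conjI AE_avg_tendsto Lp_avg_tendsto) auto
qed

end
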